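(* Let $n,k\ge1$. The channel QPE order $\sqsubseteq$ on $\mathrm{CPTP}[M_n,M_k]$ has the following properties: 1. The completely depolarizing map $D_1$, given on states by $D_1(\rho)=\bot_k=\frac1kI_k$ (i.e. $D_1(A)=\operatorname{tr}(A)\frac1kI_k$), is the bottom element (below all maps). 2. The isometries, i.e. the Kraus rank 1 channels $A\mapsto VAV^\dagger$ with $V^\dagger V=I_n$, are maximal elements. 3. The order respects the convex structure: for $\Phi,\Psi\in\mathrm{CPTP}[M_n,M_k]$, $\Phi\sqsubseteq\Psi$ iff $\Phi\sqsubseteq(1-t)\Phi+t\Psi\sqsubseteq\Psi$ for all $0\le t\le1$. It is also preserved by tensor products: if $\Phi_i,\Psi_i\in\mathrm{CPTP}[M_{n_i},M_{k_i}]$ with $\Phi_i\sqsubseteq\Psi_i$ for $i=1,2$, then $\Phi_1\otimes\Phi_2\sqsubseteq\Psi_1\otimes\Psi_2$. 4. The order is directed complete and is a domain.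
   Context: $M_n$ denotes the complex $n\times n$ matrices, and $\mathrm{CPTP}[M_n,M_k]$ is the convex set of completely positive trace-preserving linear maps $M_n\to M_k$. $DO(n)=\{A\in M_n : A\ge 0,\ \operatorname{tr}A=1\}$ is the set of states. The QPE order on states of $DO(n)$ is the partial order $\rho\sqsubseteq\sigma\iff\|\sigma\|\rho-\|\rho\|\sigma\ge0$, with $\|\cdot\|$ the operator norm and $\ge 0$ meaning positive semidefinite. The Choi–Jamiołkowski state of $\Phi\in\mathrm{CPTP}[M_n,M_k]$ is $$J(\Phi)=\frac1n\sum_{i,j=1}^nE_{ij}\otimes\Phi(E_{ij})\in M_n\otimes M_k\cong M_{nk},$$ where $E_{ij}$ is the matrix unit with $1$ at position $ij$. The channel QPE order is defined by $\Phi\sqsubseteq\Psi\iff J(\Phi)\sqsubseteq J(\Psi)$, the right-hand side being the QPE order on $DO(nk)$. For a partially ordered set $(X,\le)$: a (nonempty) subset $S$ is upwards directed when for all $x,y\in S$ there is $z\in S$ with $x,y\le z$. $X$ is directed complete when every upwards directed subset $S$ has a supremum $\vee S$. $x\ll y$ when for every upwards directed $S$ with $y\le\vee S$ there is $s\in S$ with $x\le s$. $X$ is a domain when it is directed complete and for every $x\in X$ the set $\{y : y\ll x\}$ is upwards directed with supremum $x$. *)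

theory Defs
  imports "HOL-Analysis.Analysis"
begin

(* M_n is complex^'n^'n with n = CARD('n), which is at least 1; a k x n matrix is complex^'n^'k.
   M_n (x) M_k is rendered as matrices indexed by the product type 'n \<times> 'k. *)

definition mscale :: "complex \<Rightarrow> complex^'n^'m \<Rightarrow> complex^'n^'m" where
  "mscale c A = (\<chi> i j. c * A $ i $ j)"

lemma vector_space_mscale: "vector_space mscale"
  by unfold_locales (simp_all add: mscale_def vec_eq_iff algebra_simps)

definition adjoint_mat :: "complex^'n^'m \<Rightarrow> complex^'m^'n" where
  "adjoint_mat A = (\<chi> i j. cnj (A $ j $ i))"

definition hdot :: "complex^'n \<Rightarrow> complex^'n \<Rightarrow> complex" where
  "hdot x y = (\<Sum>i\<in>UNIV. cnj (x $ i) * y $ i)"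

(* Membership in the nonnegative reals also says that the value of the form is real. *)
definition psd :: "complex^'n^'n \<Rightarrow> bool" where
  "psd A \<longleftrightarrow> (\<forall>x. hdot x (A *v x) \<in> \<real>\<^sub>\<ge>\<^sub>0)"

definition mat_unit :: "'m \<Rightarrow> 'n \<Rightarrow> complex^'n^'m" where
  "mat_unit i j = axis i (axis j 1)"

definition kron :: "complex^'n^'m \<Rightarrow> complex^'q^'p \<Rightarrow> complex^('n \<times> 'q)^('m \<times> 'p)" where
  "kron A B = (\<chi> a b. A $ fst a $ fst b * B $ snd a $ snd b)"

(* B is an m x m block matrix with blocks in M_n, i.e. an element of M_m (x) M_n; psd_block says
   that it is positive semidefinite. Indexing the blocks by natural numbers lets completely_positive
   quantify over the size m of the ancilla. *)
definition psd_block :: "nat \<Rightarrow> (nat \<Rightarrow> nat \<Rightarrow> complex^'n^'n) \<Rightarrow> bool" where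
  "psd_block m B \<longleftrightarrow>
     (\<forall>x :: nat \<Rightarrow> complex^'n. (\<Sum>i<m. \<Sum>j<m. hdot (x i) (B i j *v x j)) \<in> \<real>\<^sub>\<ge>\<^sub>0)"

(* The map id_m (x) \<Phi> acts on block matrices by applying \<Phi> to every block. *)
definition completely_positive :: "(complex^'n^'n \<Rightarrow> complex^'k^'k) \<Rightarrow> bool" where
  "completely_positive \<Phi> \<longleftrightarrow> (\<forall>m B. psd_block m B \<longrightarrow> psd_block m (\<lambda>i j. \<Phi> (B i j)))"

definition CPTP :: "(complex^'n^'n \<Rightarrow> complex^'k^'k) set" where
  "CPTP = {\<Phi>. Vector_Spaces.linear mscale mscale \<Phi> \<and> completely_positive \<Phi> \<and>
               (\<forall>A. trace (\<Phi> A) = trace A)}"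

definition op_norm :: "complex^'n^'n \<Rightarrow> real" where
  "op_norm A = onorm (\<lambda>x. A *v x)"

definition DO :: "(complex^'n^'n) set" where
  "DO = {A. psd A \<and> trace A = 1}"

definition qpe_le :: "complex^'n^'n \<Rightarrow> complex^'n^'n \<Rightarrow> bool" where
  "qpe_le \<rho> \<sigma> \<longleftrightarrow>
     \<rho> \<in> DO \<and> \<sigma> \<in> DO \<and> psd (op_norm \<sigma> *\<^sub>R \<rho> - op_norm \<rho> *\<^sub>R \<sigma>)"

definition choi_state ::
    "(complex^'n^'n \<Rightarrow> complex^'k^'k) \<Rightarrow> complex^('n \<times> 'k)^('n \<times> 'k)" where
  "choi_state \<Phi> = (1 / real CARD('n)) *\<^sub>R
     (\<Sum>i\<in>UNIV. \<Sum>j\<in>UNIV. kron (mat_unit i j :: complex^'n^'n) (\<Phi> (mat_unit i j)))"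

definition channel_le ::
    "(complex^'n^'n \<Rightarrow> complex^'k^'k) \<Rightarrow> (complex^'n^'n \<Rightarrow> complex^'k^'k) \<Rightarrow> bool" where
  "channel_le \<Phi> \<Psi> \<longleftrightarrow> qpe_le (choi_state \<Phi>) (choi_state \<Psi>)"

definition depolarizing :: "complex^'n^'n \<Rightarrow> complex^'k^'k" where
  "depolarizing A = mscale (trace A * (1 / of_nat CARD('k))) (mat 1)"

definition kraus1 :: "complex^'n^'k \<Rightarrow> complex^'n^'n \<Rightarrow> complex^'k^'k" where
  "kraus1 V A = V ** A ** adjoint_mat V"

(* The linear map determined by A (x) B \<mapsto> \<Phi> A (x) \<Psi> B, expanded in the basis of
   matrix units E_ij (x) E_pq. *)
definition tensor_map ::
    "(complex^'n^'n \<Rightarrow> complex^'k^'k) \<Rightarrow> (complex^'m^'m \<Rightarrow> complex^'l^'l) \<Rightarrow>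
     complex^('n \<times> 'm)^('n \<times> 'm) \<Rightarrow> complex^('k \<times> 'l)^('k \<times> 'l)" where
  "tensor_map \<Phi> \<Psi> X =
     (\<Sum>i\<in>UNIV. \<Sum>j\<in>UNIV. \<Sum>p\<in>UNIV. \<Sum>q\<in>UNIV.
        mscale (X $ (i, p) $ (j, q)) (kron (\<Phi> (mat_unit i j)) (\<Psi> (mat_unit p q))))"

definition poset_on :: "'a set \<Rightarrow> ('a \<Rightarrow> 'a \<Rightarrow> bool) \<Rightarrow> bool" where
  "poset_on X le \<longleftrightarrow> reflp_on X le \<and> transp_on X le \<and> antisymp_on X le"

definition up_directed :: "'a set \<Rightarrow> ('a \<Rightarrow> 'a \<Rightarrow> bool) \<Rightarrow> 'a set \<Rightarrow> bool" where
  "up_directed X le S \<longleftrightarrow>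
     S \<subseteq> X \<and> S \<noteq> {} \<and> (\<forall>x\<in>S. \<forall>y\<in>S. \<exists>z\<in>S. le x z \<and> le y z)"

definition is_supremum :: "'a set \<Rightarrow> ('a \<Rightarrow> 'a \<Rightarrow> bool) \<Rightarrow> 'a set \<Rightarrow> 'a \<Rightarrow> bool" where
  "is_supremum X le S u \<longleftrightarrow>
     u \<in> X \<and> (\<forall>s\<in>S. le s u) \<and> (\<forall>v\<in>X. (\<forall>s\<in>S. le s v) \<longrightarrow> le u v)"

definition directed_complete :: "'a set \<Rightarrow> ('a \<Rightarrow> 'a \<Rightarrow> bool) \<Rightarrow> bool" where
  "directed_complete X le \<longleftrightarrow>
     poset_on X le \<and> (\<forall>S. up_directed X le S \<longrightarrow> (\<exists>u. is_supremum X le S u))"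

definition way_below :: "'a set \<Rightarrow> ('a \<Rightarrow> 'a \<Rightarrow> bool) \<Rightarrow> 'a \<Rightarrow> 'a \<Rightarrow> bool" where
  "way_below X le x y \<longleftrightarrow>
     (\<forall>S u. up_directed X le S \<longrightarrow> is_supremum X le S u \<longrightarrow> le y u \<longrightarrow> (\<exists>s\<in>S. le x s))"

definition continuous_domain :: "'a set \<Rightarrow> ('a \<Rightarrow> 'a \<Rightarrow> bool) \<Rightarrow> bool" where
  "continuous_domain X le \<longleftrightarrow> directed_complete X le \<and>
     (\<forall>x\<in>X. up_directed X le {y \<in> X. way_below X le y x} \<and>
             is_supremum X le {y \<in> X. way_below X le y x} x)"

end

theory Submission
  imports Defs
begin

text \<open>A channel is determined by its Choi state, and the Choi states of channels form the compact
  convex set of positive semidefinite matrices whose first marginal is \<open>I/n\<close>. On states, \<open>\<rho> \<sqsubseteq> \<sigma>\<close>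
  means that \<open>\<rho>/\<parallel>\<rho>\<parallel> \<ge> \<sigma>/\<parallel>\<sigma>\<parallel>\<close>; taking traces shows that the norm is strictly monotone, so a
  state of norm 1 (a pure state, such as the Choi state of an isometry) is maximal. If \<open>\<rho> \<sqsubseteq> \<sigma>\<close>, a
  top eigenvector of \<open>\<sigma>\<close> is one of \<open>\<rho>\<close>, so the norm is affine on the segment between them. The
  order is closed on a compact set, so a directed set has a supremum in its closure. Finally, the
  mixtures \<open>(1 - t) \<bottom> + t x\<close> with \<open>t < 1\<close> are way below \<open>x\<close> and approximate it.\<close>

section \<open>Positive operators and positive semidefinite matrices\<close>

text \<open>The delicate point is approximation. Write A' for a state divided by its operator norm.
  A member s of a directed set close to its supremum u has s' close to u', but the way-below
  relation asks for an inequality, and closeness in norm gives none along the top eigenspace of u,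
  where I - u' vanishes. The order itself repairs this: s below u forces u' \<le> s' \<le> I, so the
  error s' - u' vanishes on the same eigenspace, while on its orthogonal complement I - u' is
  bounded below. Mixing with the bottom state, whose normalisation is I, supplies the slack.

  No full diagonalisation is used. A top eigenvector, found by maximising the quadratic form on the
  unit sphere, controls operator norms; a decomposition into rank-one matrices reduces complete
  positivity, tensor products and the trace bound to the rank-one case. Compactness and limits are
  used on Choi matrices only, and the order-theoretic conclusions are carried back along the Choi
  bijection.\<close>

definition pos_op :: "('a::euclidean_space \<Rightarrow> 'a) \<Rightarrow> bool" where
  "pos_op T \<longleftrightarrow> linear T \<and> (\<forall>x y. T x \<bullet> y = x \<bullet> T y) \<and> (\<forall>x. 0 \<le> x \<bullet> T x)"

text \<open>The form at \<open>x + t *\<^sub>R y\<close> is a nonnegative polynomial in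
  \<open>t\<close> of degree at most two. If the leading coefficient is positive, its minimum gives
  the inequality; otherwise it is affine and must be constant.\<close>

lemma pos_op_Cauchy_Schwarz:
  assumes "pos_op T"
  shows "(x \<bullet> T y)\<^sup>2 \<le> (x \<bullet> T x) * (y \<bullet> T y)"
proof -
  have lin: "linear T" and sym: "\<And>u v. T u \<bullet> v = u \<bullet> T v" and pos: "\<And>u. 0 \<le> u \<bullet> T u"
    using assms by (auto simp: pos_op_def)
  define a b c where "a = x \<bullet> T x" and "b = x \<bullet> T y" and "c = y \<bullet> T y"
  have "y \<bullet> T x = b"
    using sym[of y x] by (simp add: b_def inner_commute)
  then have quad: "0 \<le> a + 2 * t * b + t\<^sup>2 * c" for t
    using pos[of "x + t *\<^sub>R y"]
    by (simp add: linear_add[OF lin] linear_scale[OF lin] inner_add inner_scaleR_right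
        a_def b_def c_def power2_eq_square algebra_simps)
  show ?thesis
  proof (cases "c = 0")
    case True
    have "b = 0"
    proof (rule ccontr)
      assume "b \<noteq> 0"
      \<comment> \<open>With this \<open>t\<close> the affine function takes the value -1.\<close>
      then show False using quad[of "- (a + 1) / (2 * b)"] True by (simp add: field_simps)
    qed
    then show ?thesis using True by (simp add: a_def b_def c_def)
  next
    case False
    then have "c > 0" using pos[of y] by (simp add: c_def)
    then have "b\<^sup>2 \<le> a * c"
      using quad[of "- b / c"] by (simp add: field_simps power2_eq_square)
    then show ?thesis by (simp add: a_def b_def c_def)
  qed
qed

text \<open>A zero of a nonnegative form minimises it, so its gradient, a multiple of
  \<open>T x\<close>, vanishes there; algebraically this is Cauchy-Schwarz against
  \<open>T x\<close> itself.\<close>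

lemma pos_op_kernel:
  assumes "pos_op T" "x \<bullet> T x = 0"
  shows "T x = 0"
proof -
  have "(T x \<bullet> T x)\<^sup>2 \<le> 0"
    using pos_op_Cauchy_Schwarz[OF assms(1), of "T x" x] assms(2) by simp
  then show ?thesis by simp
qed

lemma inner_le_onorm:
  fixes T :: "'a::euclidean_space \<Rightarrow> 'a"
  assumes "linear T"
  shows "x \<bullet> T x \<le> onorm T * (x \<bullet> x)"
proof -
  have "x \<bullet> T x \<le> norm x * norm (T x)" by (rule norm_cauchy_schwarz)
  also have "\<dots> \<le> norm x * (onorm T * norm x)"
    using onorm[of T x] assms by (intro mult_left_mono) (auto simp: linear_conv_bounded_linear)
  finally show ?thesis by (simp add: dot_square_norm power2_eq_square algebra_simps)
qed

text \<open>The maximiser \<open>v\<close> of the form on the unit sphere is an eigenvector because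
  \<open>m\<close> times the identity minus \<open>T\<close> is positive and its form vanishes at
  \<open>v\<close>. That \<open>m\<close> is also the operator norm needs Cauchy-Schwarz for the
  form of \<open>T\<close>.\<close>

lemma pos_op_top_eigenvector:
  fixes T :: "'a::euclidean_space \<Rightarrow> 'a"
  assumes T: "pos_op T"
  obtains v where "norm v = 1" "T v = onorm T *\<^sub>R v"
proof -
  have lin: "linear T" and sym: "\<And>u v. T u \<bullet> v = u \<bullet> T v" and pos: "\<And>u. 0 \<le> u \<bullet> T u"
    using T by (auto simp: pos_op_def)
  have bl: "bounded_linear T" using lin by (simp add: linear_conv_bounded_linear)
  obtain b :: 'a where "b \<in> Basis" using nonempty_Basis by blast
  then have "sphere (0::'a) 1 \<noteq> {}" by (auto intro!: exI[of _ b])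
  moreover have "continuous_on (sphere 0 1) (\<lambda>x. x \<bullet> T x)"
    by (intro continuous_intros linear_continuous_on bl)
  ultimately obtain v where v: "v \<in> sphere 0 1" and
    max: "\<And>x. x \<in> sphere 0 1 \<Longrightarrow> x \<bullet> T x \<le> v \<bullet> T v"
    using continuous_attains_sup[OF compact_sphere, of 0 1 "\<lambda>x. x \<bullet> T x"] by blast
  define m where "m = v \<bullet> T v"
  have nv: "norm v = 1" using v by simp
  have m0: "m \<ge> 0" using pos by (simp add: m_def)
  have ub: "x \<bullet> T x \<le> m * (x \<bullet> x)" for x
  proof (cases "x = 0")
    case True then show ?thesis by (simp add: linear_0[OF lin])
  next
    case False
    then have "(x /\<^sub>R norm x) \<bullet> T (x /\<^sub>R norm x) \<le> m"
      unfolding m_def by (intro max) simp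
    then have "(x \<bullet> T x) / (norm x)\<^sup>2 \<le> m"
      by (simp add: linear_scale[OF lin] power2_eq_square divide_inverse mult_ac)
    then show ?thesis using False by (simp add: field_simps dot_square_norm)
  qed
  have "pos_op (\<lambda>x. m *\<^sub>R x - T x)"
    unfolding pos_op_def
  proof (intro conjI allI)
    show "linear (\<lambda>x. m *\<^sub>R x - T x)" by (intro linear_compose_sub linear_scale_self lin)
    show "(m *\<^sub>R x - T x) \<bullet> y = x \<bullet> (m *\<^sub>R y - T y)" for x y
      by (simp add: inner_diff_left inner_diff_right sym)
    show "0 \<le> x \<bullet> (m *\<^sub>R x - T x)" for x using ub by (simp add: inner_diff_right)
  qed
  moreover have "v \<bullet> (m *\<^sub>R v - T v) = 0"
    using nv by (simp add: inner_diff m_def dot_square_norm)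
  ultimately have eig: "T v = m *\<^sub>R v" using pos_op_kernel[of "\<lambda>x. m *\<^sub>R x - T x" v] by simp
  \<comment> \<open>The square of \<open>T x \<bullet> T x\<close> is at most the product of the
    forms at \<open>T x\<close> and at \<open>x\<close>, each at most \<open>m\<close> times a
    squared norm; one factor \<open>T x \<bullet> T x\<close> then cancels.\<close>
  have "norm (T x) \<le> m * norm x" for x
  proof (cases "T x = 0")
    case False
    have "(T x \<bullet> T x)\<^sup>2 \<le> (T x \<bullet> T (T x)) * (x \<bullet> T x)"
      by (rule pos_op_Cauchy_Schwarz[OF T])
    also have "\<dots> \<le> (m * (T x \<bullet> T x)) * (m * (x \<bullet> x))"
      by (intro mult_mono ub pos) (auto simp: m0)
    finally have "(T x \<bullet> T x) * (T x \<bullet> T x) \<le> (T x \<bullet> T x) * (m\<^sup>2 * (x \<bullet> x))"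
      by (simp add: power2_eq_square mult_ac)
    then have "T x \<bullet> T x \<le> m\<^sup>2 * (x \<bullet> x)"
      using False by (subst (asm) mult_le_cancel_left_pos) auto
    then have "(norm (T x))\<^sup>2 \<le> (m * norm x)\<^sup>2"
      by (simp add: dot_square_norm power_mult_distrib)
    then show ?thesis by (rule power2_le_imp_le) (simp add: m0)
  qed (use m0 in auto)
  then have "onorm T \<le> m" by (rule onorm_le)
  moreover have "m \<le> onorm T" using onorm[OF bl, of v] nv m0 by (simp add: eig)
  ultimately show ?thesis using that nv eig by simp
qed

text \<open>The kernel of \<open>H\<close> lies in that of \<open>D\<close>, and \<open>H\<close> is bounded below on the orthogonal
  complement of its kernel.\<close>

lemma pos_op_dominated:
  fixes H :: "'a::euclidean_space \<Rightarrow> 'a"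
  assumes H: "pos_op H" and "\<mu> > 0"
  obtains \<epsilon> where "\<epsilon> > 0"
    "\<And>D x. pos_op D \<Longrightarrow> (\<And>y. y \<bullet> D y \<le> y \<bullet> H y) \<Longrightarrow> onorm D \<le> \<epsilon> \<Longrightarrow> x \<bullet> D x \<le> \<mu> * (x \<bullet> H x)"
proof -
  have lin: "linear H" and sym: "\<And>u v. H u \<bullet> v = u \<bullet> H v" and pos: "\<And>u. 0 \<le> u \<bullet> H u"
    using H by (auto simp: pos_op_def)
  define K where "K = {v. H v = 0}"
  define N where "N = sphere 0 1 \<inter> {x. \<forall>w\<in>K. orthogonal w x}"
  have K: "subspace K" unfolding K_def by (rule linear_subspace_kernel[OF lin])
  have "closed {x. \<forall>w\<in>K. orthogonal w x}"
    by (rule closed_subspace) (auto intro: subspace_orthogonal_to_vectors)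
  then have N: "compact N" unfolding N_def by (intro compact_Int_closed) auto
  have contH: "continuous_on N (\<lambda>x. x \<bullet> H x)"
    using lin by (intro continuous_intros linear_continuous_on) (simp add: linear_conv_bounded_linear)
  obtain \<delta> where \<delta>: "\<delta> > 0" "\<And>x. x \<in> N \<Longrightarrow> \<delta> \<le> x \<bullet> H x"
  proof (cases "N = {}")
    case False
    then obtain x where x: "x \<in> N" "\<And>y. y \<in> N \<Longrightarrow> x \<bullet> H x \<le> y \<bullet> H y"
      using continuous_attains_inf[OF N _ contH] by metis
    have "x \<bullet> H x \<noteq> 0"
    proof
      assume "x \<bullet> H x = 0"
      then have "x \<in> K" using pos_op_kernel[OF H] by (simp add: K_def)
      then show False using x(1) by (auto simp: N_def orthogonal_def)
    qed
    then show ?thesis using that[of "x \<bullet> H x"] x(2) pos[of x] by force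
  \<comment> \<open>No unit vector is orthogonal to the kernel, so any positive
    \<open>\<delta>\<close> serves.\<close>
  qed (use that[of 1] in auto)
  have coercive: "\<delta> * (f \<bullet> f) \<le> f \<bullet> H f" if "\<forall>w\<in>K. orthogonal w f" for f
  proof (cases "f = 0")
    case False
    have "f /\<^sub>R norm f \<in> N" using that False by (simp add: N_def orthogonal_clauses)
    then have "\<delta> \<le> (f \<bullet> H f) / (norm f)\<^sup>2"
      using \<delta>(2) by (fastforce simp: linear_scale[OF lin] power2_eq_square divide_inverse mult_ac)
    then show ?thesis using False by (simp add: field_simps dot_square_norm)
  qed (simp add: linear_0[OF lin])
  \<comment> \<open>Symmetry moves \<open>T\<close> onto the kernel vector, which kills the cross
    terms.\<close>
  have split: "(e + f) \<bullet> T (e + f) = f \<bullet> T f" if "pos_op T" "T e = 0" for T :: "'a \<Rightarrow> 'a" and e f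
  proof -
    have "e \<bullet> T f = T e \<bullet> f" using that(1) unfolding pos_op_def by metis
    then have "e \<bullet> T f = 0" using that(2) by simp
    then show ?thesis using that by (simp add: pos_op_def linear_add inner_add)
  qed
  show ?thesis
  proof
    show "\<mu> * \<delta> > 0" using \<delta> assms by simp
    fix D x
    assume D: "pos_op D" and le: "\<And>y. y \<bullet> D y \<le> y \<bullet> H y" and small: "onorm D \<le> \<mu> * \<delta>"
    obtain e f where e: "e \<in> span K" and f: "\<And>w. w \<in> span K \<Longrightarrow> orthogonal f w" and x: "x = e + f"
      using orthogonal_subspace_decomp_exists[of K x] by metis
    have eK: "e \<in> K" using e K by (simp add: span_eq_iff[THEN iffD2])
    then have He: "H e = 0" by (simp add: K_def)
    have "e \<bullet> D e = 0" using le[of e] He D by (auto simp: pos_op_def intro: antisym)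
    then have De: "D e = 0" using pos_op_kernel[OF D] by simp
    have "f \<bullet> D f \<le> onorm D * (f \<bullet> f)" using D by (intro inner_le_onorm) (simp add: pos_op_def)
    also have "\<dots> \<le> \<mu> * (\<delta> * (f \<bullet> f))"
      using mult_right_mono[OF small, of "f \<bullet> f"] by (simp add: mult_ac)
    also have "\<dots> \<le> \<mu> * (f \<bullet> H f)"
      using assms f by (intro mult_left_mono coercive) (auto simp: orthogonal_commute span_base)
    finally show "x \<bullet> D x \<le> \<mu> * (x \<bullet> H x)"
      using split[OF D De] split[OF H He] by (simp add: x)
  qed
qed

section \<open>Complex matrices as real operators\<close>

definition hermitian :: "complex^'n^'n \<Rightarrow> bool" where
  "hermitian A \<longleftrightarrow> (\<forall>i j. A $ i $ j = cnj (A $ j $ i))"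

text \<open>The inner product of \<open>complex^'n\<close> is the real part of \<open>hdot\<close>,
  so for Hermitian \<open>A\<close> nothing is lost on the diagonal of the form. This makes the
  results on \<open>pos_op\<close> available for matrices.\<close>

definition qf :: "complex^'n^'n \<Rightarrow> complex^'n \<Rightarrow> real" where
  "qf A x = x \<bullet> (A *v x)"

lemma Re_hdot: "Re (hdot x y) = x \<bullet> y"
  by (simp add: hdot_def inner_vec_def inner_complex_def)

lemma cnj_hdot: "cnj (hdot x y) = hdot y x"
  by (simp add: hdot_def mult.commute)

lemma hdot_add_left: "hdot (x + y) z = hdot x z + hdot y z"
  and hdot_add_right: "hdot x (y + z) = hdot x y + hdot x z"
  and hdot_scale_left: "hdot (c *s x) y = cnj c * hdot x y"
  and hdot_scale_right: "hdot x (c *s y) = c * hdot x y"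
  by (simp_all add: hdot_def algebra_simps sum.distrib sum_distrib_left)

lemma hdot_self: "hdot x x = of_real (x \<bullet> x)"
  by (rule complex_eqI) (simp_all add: Re_hdot, simp add: hdot_def)

lemma hdot_mat_eq: "hdot x (A *v y) = (\<Sum>i\<in>UNIV. \<Sum>j\<in>UNIV. cnj (x $ i) * A $ i $ j * y $ j)"
  by (simp add: hdot_def matrix_vector_mult_def sum_distrib_left mult.assoc)

lemma hermitian_hdot:
  assumes "hermitian A"
  shows "hdot (A *v x) y = hdot x (A *v y)"
proof -
  have entry: "cnj (A $ i $ j) = A $ j $ i" for i j
    using assms unfolding hermitian_def by (metis complex_cnj_cnj)
  have "hdot (A *v x) y = cnj (hdot y (A *v x))" by (simp add: cnj_hdot)
  also have "\<dots> = (\<Sum>i\<in>UNIV. \<Sum>j\<in>UNIV. cnj (x $ j) * cnj (A $ i $ j) * y $ i)"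
    by (simp add: hdot_mat_eq mult_ac)
  also have "\<dots> = (\<Sum>i\<in>UNIV. \<Sum>j\<in>UNIV. cnj (x $ j) * A $ j $ i * y $ i)"
    by (simp add: entry)
  also have "\<dots> = hdot x (A *v y)" unfolding hdot_mat_eq by (rule sum.swap)
  finally show ?thesis .
qed

lemma matrix_vector_mult_vscale: "A *v (c *s x) = c *s (A *v x)" for A :: "complex^'n^'m"
  by (simp add: vec_eq_iff matrix_vector_mult_def sum_distrib_left mult_ac)

lemma hdot_axis: "hdot (axis i 1) (A *v axis j 1) = A $ i $ j"
  by (simp add: hdot_def axis_def matrix_vector_mult_def if_distrib[of cnj] if_distrib[of "(*) _"]
      if_distrib[of "\<lambda>c. c * _"] cong: if_cong)

text \<open>Polarisation: reality of the form at \<open>x + y\<close> compares the imaginary parts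
  of \<open>B x y\<close> and \<open>B y x\<close>, reality at \<open>x + \<i> *s y\<close> their
  real parts.\<close>

lemma psd_hermitian:
  assumes "psd A"
  shows "hermitian A"
proof -
  define B where "B x y = hdot x (A *v y)" for x y
  have real: "Im (B x x) = 0" for x
    using assms complex_nonneg_Reals_iff by (auto simp: psd_def B_def)
  have "B x y = cnj (B y x)" for x y
  proof (rule complex_eqI)
    have "Im (B (x + y) (x + y)) = 0" by (rule real)
    then show "Im (B x y) = Im (cnj (B y x))"
      using real[of x] real[of y]
      by (simp add: B_def hdot_add_left hdot_add_right matrix_vector_right_distrib)
    have "Im (B (x + \<i> *s y) (x + \<i> *s y)) = 0" by (rule real)
    then show "Re (B x y) = Re (cnj (B y x))"
      using real[of x] real[of y]
      by (simp add: B_def hdot_add_left hdot_add_right matrix_vector_right_distrib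
          matrix_vector_mult_vscale hdot_scale_left hdot_scale_right)
  qed
  then have "B (axis i 1) (axis j 1) = cnj (B (axis j 1) (axis i 1))" for i j .
  then show ?thesis unfolding hermitian_def B_def hdot_axis by blast
qed

lemma psd_iff: "psd A \<longleftrightarrow> hermitian A \<and> (\<forall>x. 0 \<le> qf A x)"
proof -
  have "hdot x (A *v x) \<in> \<real>\<^sub>\<ge>\<^sub>0 \<longleftrightarrow> 0 \<le> qf A x" if "hermitian A" for x
  proof -
    have "cnj (hdot x (A *v x)) = hdot x (A *v x)"
      using hermitian_hdot[OF that, of x x] by (simp add: cnj_hdot)
    then have "Im (hdot x (A *v x)) = 0" by (simp add: complex_eq_iff)
    then show ?thesis by (simp add: complex_nonneg_Reals_iff Re_hdot qf_def)
  qed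
  then show ?thesis using psd_hermitian by (auto simp: psd_def)
qed

lemma psd_pos_op:
  assumes "psd A"
  shows "pos_op ((*v) A)"
proof -
  have "(A *v x) \<bullet> y = x \<bullet> (A *v y)" for x y
    using hermitian_hdot[OF psd_hermitian[OF assms], of x y] by (metis Re_hdot)
  then show ?thesis
    using assms by (auto simp: pos_op_def psd_iff qf_def matrix_vector_mul_linear)
qed

lemma scaleR_mat_vec: "(c *\<^sub>R A) *v x = c *\<^sub>R (A *v x)" for A :: "complex^'n^'m"
  by (simp add: vec_eq_iff matrix_vector_mult_def scaleR_sum_right)

lemma qf_simps [simp]:
  "qf (A + B) x = qf A x + qf B x"
  "qf (A - B) x = qf A x - qf B x"
  "qf (c *\<^sub>R A) x = c * qf A x"
  "qf (mat 1) x = x \<bullet> x"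
  "qf 0 x = 0"
  by (simp_all add: qf_def matrix_vector_mult_add_rdistrib matrix_vector_mult_diff_rdistrib
      inner_add inner_diff scaleR_mat_vec)

lemma hermitian_simps [simp]:
  "hermitian A \<Longrightarrow> hermitian B \<Longrightarrow> hermitian (A + B)"
  "hermitian A \<Longrightarrow> hermitian (c *\<^sub>R A)"
  "hermitian (mat 1)"
  "hermitian 0"
proof -
  show "hermitian (A + B)" if A: "hermitian A" and B: "hermitian B"
    unfolding hermitian_def
  proof (intro allI)
    fix i j
    have "A $ i $ j = cnj (A $ j $ i)" "B $ i $ j = cnj (B $ j $ i)"
      using A B unfolding hermitian_def by blast+
    then show "(A + B) $ i $ j = cnj ((A + B) $ j $ i)" by simp
  qed
  show smult: "hermitian (c *\<^sub>R A)" if A: "hermitian A" for c A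
    unfolding hermitian_def
  proof (intro allI)
    fix i j
    have "A $ i $ j = cnj (A $ j $ i)"
      using A unfolding hermitian_def by blast
    then show "(c *\<^sub>R A) $ i $ j = cnj ((c *\<^sub>R A) $ j $ i)" by simp
  qed
qed (auto simp: hermitian_def mat_def)

lemma hermitian_diff [simp]: "hermitian A \<Longrightarrow> hermitian B \<Longrightarrow> hermitian (A - B)"
  using hermitian_simps(1)[OF _ hermitian_simps(2), of A B "- 1"] by simp

lemma psd_add: "psd A \<Longrightarrow> psd B \<Longrightarrow> psd (A + B)"
  and psd_scaleR: "0 \<le> c \<Longrightarrow> psd A \<Longrightarrow> psd (c *\<^sub>R A)"
  and psd_mat1: "psd (mat 1)"
  and psd_zero: "psd 0"
  by (simp_all add: psd_iff)

lemma op_norm_eq: "op_norm A = onorm ((*v) A)"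
  by (simp add: op_norm_def)

lemma op_norm_nonneg: "0 \<le> op_norm A"
  unfolding op_norm_eq
  by (intro onorm_pos_le) (simp add: linear_conv_bounded_linear[symmetric] matrix_vector_mul_linear)

lemma qf_le_op_norm: "qf A x \<le> op_norm A * (x \<bullet> x)"
  unfolding op_norm_eq qf_def by (rule inner_le_onorm) (simp add: matrix_vector_mul_linear)

lemma psd_top_eigenvector:
  assumes "psd A"
  obtains v where "norm v = 1" "A *v v = op_norm A *\<^sub>R v" "qf A v = op_norm A"
proof -
  obtain v where "norm v = 1" "A *v v = op_norm A *\<^sub>R v"
    using pos_op_top_eigenvector[OF psd_pos_op[OF assms]] by (metis op_norm_eq)
  then show ?thesis using that by (simp add: qf_def dot_square_norm)
qed

lemma op_norm_le:
  assumes "psd A" "\<And>x. qf A x \<le> c * (x \<bullet> x)"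
  shows "op_norm A \<le> c"
proof -
  obtain v where "norm v = 1" "qf A v = op_norm A" using psd_top_eigenvector[OF assms(1)] .
  then show ?thesis using assms(2)[of v] by (simp add: dot_square_norm)
qed

lemma op_norm_eqI:
  assumes "psd A" "\<And>x. qf A x \<le> c * (x \<bullet> x)" "v \<noteq> 0" "c * (v \<bullet> v) \<le> qf A v"
  shows "op_norm A = c"
proof (rule antisym)
  show "op_norm A \<le> c" using assms(1,2) by (rule op_norm_le)
  have "c * (v \<bullet> v) \<le> op_norm A * (v \<bullet> v)" using assms(4) qf_le_op_norm[of A v] by linarith
  then show "c \<le> op_norm A" using assms(3) by (simp add: mult_le_cancel_right)
qed

section \<open>The QPE order\<close>

definition outer :: "complex^'n \<Rightarrow> complex^'n^'n" where
  "outer w = (\<chi> i j. w $ i * cnj (w $ j))"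

lemma outer_mat_vec: "outer w *v x = hdot w x *s w"
  by (simp add: vec_eq_iff outer_def matrix_vector_mult_def hdot_def sum_distrib_left
      sum_distrib_right mult_ac)

lemma hdot_outer: "hdot x (outer w *v x) = of_real ((cmod (hdot w x))\<^sup>2)"
  unfolding complex_norm_square by (simp add: outer_mat_vec hdot_scale_right cnj_hdot)

lemma qf_eq_Re: "qf A x = Re (hdot x (A *v x))"
  by (simp add: qf_def Re_hdot)

lemma qf_outer: "qf (outer w) x = (cmod (hdot w x))\<^sup>2"
  by (simp add: qf_eq_Re hdot_outer)

lemma psd_outer: "psd (outer w)"
  by (simp add: psd_def hdot_outer)

text \<open>The real inequality controls only the real part of \<open>hdot\<close>. Replacing
  \<open>w\<close> by \<open>h *s w\<close> with \<open>h = hdot w x\<close> makes the product the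
  real number \<open>(cmod h)\<^sup>2\<close>, and one such factor cancels.\<close>

lemma hdot_Cauchy_Schwarz: "(cmod (hdot w x))\<^sup>2 \<le> (w \<bullet> w) * (x \<bullet> x)"
proof -
  define h where "h = hdot w x"
  have "Re (hdot (h *s w) x) = (cmod h)\<^sup>2"
    by (simp add: hdot_scale_left h_def[symmetric] cmod_power2 flip: power2_eq_square)
  then have "((cmod h)\<^sup>2)\<^sup>2 \<le> ((h *s w) \<bullet> (h *s w)) * (x \<bullet> x)"
    using Cauchy_Schwarz_ineq[of "h *s w" x] by (simp add: Re_hdot)
  also have "(h *s w) \<bullet> (h *s w) = (cmod h)\<^sup>2 * (w \<bullet> w)"
  proof -
    have "hdot (h *s w) (h *s w) = (h * cnj h) * hdot w w"
      by (simp add: hdot_scale_left hdot_scale_right mult_ac)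
    then have "hdot (h *s w) (h *s w) = of_real ((cmod h)\<^sup>2 * (w \<bullet> w))"
      by (simp only: of_real_mult complex_norm_square hdot_self)
    then show ?thesis by (metis Re_hdot Re_complex_of_real)
  qed
  finally have "(cmod h)\<^sup>2 * (cmod h)\<^sup>2 \<le> (cmod h)\<^sup>2 * ((w \<bullet> w) * (x \<bullet> x))"
    by (simp add: power2_eq_square mult_ac)
  then show ?thesis
    unfolding h_def[symmetric] by (cases "h = 0") (simp_all only: mult_le_cancel_left_pos zero_less_power2
        norm_eq_zero not_False_eq_True norm_zero, simp)
qed

text \<open>Cholesky decomposition: subtracting \<open>outer w\<close>, where \<open>w\<close> is a rescaled column with nonzero
  diagonal entry, keeps the matrix positive semidefinite and clears that row and column.\<close>

lemma psd_induct [consumes 1, case_names zero add_outer]: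
  fixes A :: "complex^'n^'n"
  assumes "psd A" and zero: "P 0" and step: "\<And>B w. psd B \<Longrightarrow> P B \<Longrightarrow> P (B + outer w)"
  shows "P A"
proof -
  \<comment> \<open>\<open>S\<close> contains all rows that may still be nonzero.\<close>
  have "P A" if "finite S" "psd A" "\<forall>i. i \<notin> S \<longrightarrow> (\<forall>j. A $ i $ j = 0)" for S and A :: "complex^'n^'n"
    using that
  proof (induction S arbitrary: A rule: finite_induct)
    case empty
    then have "A = 0" by (simp add: vec_eq_iff)
    then show ?case using zero by simp
  next
    case (insert k S)
    define e :: "complex^'n" where "e = axis k 1"
    define u where "u = A *v e"
    define r where "r = qf A e"
    have herm: "hermitian A" and r0: "r \<ge> 0" using insert.prems(1) by (auto simp: psd_iff r_def)
    have u: "u $ i = A $ i $ k" for i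
      by (simp add: u_def e_def matrix_vector_mult_def axis_def if_distrib[of "(*) _"] cong: if_cong)
    have conj: "A $ k $ j = cnj (A $ j $ k)" for j using herm unfolding hermitian_def by blast
    have "hdot e u \<in> \<real>\<^sub>\<ge>\<^sub>0" using insert.prems(1) by (simp add: psd_def u_def)
    then have eu: "hdot e u = of_real r"
      by (simp add: r_def u_def qf_eq_Re complex_nonneg_Reals_iff complex_eq_iff)
    have Akk: "A $ k $ k = of_real r"
      using eu by (simp add: u_def e_def hdot_axis)
    show ?case
    proof (cases "r = 0")
      case True
      \<comment> \<open>A vanishing pivot is a zero of the form at \<open>e\<close>, so the whole
        column vanishes and nothing has to be subtracted.\<close>
      then have "u = 0"
        using pos_op_kernel[OF psd_pos_op[OF insert.prems(1)], of e] by (simp add: u_def r_def qf_def)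
      then have k0: "A $ k $ j = 0" for j using u[of j] conj[of j] by simp
      show ?thesis
      proof (rule insert.IH[OF insert.prems(1)], intro allI impI)
        fix i j assume "i \<notin> S"
        then show "A $ i $ j = 0" using k0 insert.prems(2) by (cases "i = k") auto
      qed
    next
      case False
      define w where "w = (\<chi> i. u $ i / of_real (sqrt r))"
      define B where "B = A - outer w"
      have r: "r > 0" using False r0 by simp
      then have sq: "complex_of_real (sqrt r) * complex_of_real (sqrt r) = complex_of_real r"
        by (simp flip: of_real_mult)
      have ww: "w $ i * cnj (w $ j) = A $ i $ k * cnj (A $ j $ k) / of_real r" for i j
        by (simp add: w_def u sq)
      have psdB: "psd B"
        unfolding psd_def
      proof
        fix x
        \<comment> \<open>Completing the square: \<open>x + (-c) *s e\<close> minimises the form of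
          \<open>A\<close> along the direction \<open>e\<close>, and the minimum is the value at
          \<open>x\<close> of the Schur complement \<open>B\<close>.\<close>
        define c where "c = hdot u x / of_real r"
        have ex: "hdot e (A *v x) = of_real r * c"
          using hermitian_hdot[OF herm, of e x] r by (simp add: c_def u_def)
        have xe: "hdot x u = of_real r * cnj c"
          using cnj_hdot[of u x] r by (simp add: c_def)
        have "hdot (x + (-c) *s e) (A *v (x + (-c) *s e)) =
            hdot x (A *v x) - of_real r * (c * cnj c)"
          unfolding matrix_vector_right_distrib matrix_vector_mult_vscale hdot_add_left hdot_add_right
            hdot_scale_left hdot_scale_right u_def[symmetric] ex xe eu
          by (simp add: algebra_simps)
        moreover have "hdot x (B *v x) = hdot x (A *v x) - of_real r * (c * cnj c)"
        proof -
          have "hdot w x = hdot u x / of_real (sqrt r)"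
            by (simp add: w_def hdot_def sum_divide_distrib)
          then have ux: "hdot u x = of_real (sqrt r) * hdot w x" using r by simp
          then have "of_real ((cmod (hdot w x))\<^sup>2) = of_real r * (c * cnj c)"
            unfolding complex_norm_square
          proof -
            have "c * cnj c = (complex_of_real (sqrt r) * complex_of_real (sqrt r)) *
                (hdot w x * cnj (hdot w x)) / (of_real r * of_real r)"
              by (simp add: c_def ux mult_ac)
            then show "hdot w x * cnj (hdot w x) = of_real r * (c * cnj c)"
              unfolding sq using r by simp
          qed
          moreover have "hdot x (B *v x) = hdot x (A *v x) - hdot x (outer w *v x)"
            by (simp add: B_def matrix_vector_mult_diff_rdistrib hdot_def algebra_simps sum_subtractf)
          ultimately show ?thesis by (simp add: hdot_outer)
        qed
        ultimately show "hdot x (B *v x) \<in> \<real>\<^sub>\<ge>\<^sub>0"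
          using insert.prems(1) unfolding psd_def by metis
      qed
      have "B $ i $ j = 0" if "i \<notin> S" for i j
      proof (cases "i = k")
        case True
        have "w $ k * cnj (w $ j) = A $ k $ j"
          using ww[of k j] r unfolding Akk conj[of j] by simp
        then show ?thesis using True by (simp add: B_def outer_def)
      next
        case False
        then show ?thesis using that insert.prems(2) ww[of i j] by (simp add: B_def outer_def)
      qed
      then have "P B" using insert.IH[OF psdB] by blast
      then have "P (B + outer w)" by (rule step[OF psdB])
      then show ?thesis by (simp add: B_def)
    qed
  qed
  from this[of UNIV A] show ?thesis using assms(1) by simp
qed

lemma trace_add: "trace (A + B) = trace A + trace B"
  and trace_scaleR: "trace (c *\<^sub>R A) = c *\<^sub>R trace A"
  for A B :: "complex^'n^'n"
  by (simp_all add: trace_def sum.distrib scaleR_sum_right)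

lemma trace_diff: "trace (A - B) = trace A - trace B" for A B :: "complex^'n^'n"
  by (simp add: trace_def sum_subtractf)

lemma trace_outer: "trace (outer w) = of_real (w \<bullet> w)"
  by (simp add: trace_def outer_def hdot_self[symmetric] hdot_def mult.commute)

text \<open>Tested on a vector, both sides are additive in \<open>A\<close>, so the rank-one case
  decides; there it is Cauchy-Schwarz.\<close>

lemma op_norm_le_trace:
  assumes "psd A"
  shows "op_norm A \<le> Re (trace A)"
proof (rule op_norm_le[OF assms])
  fix x
  show "qf A x \<le> Re (trace A) * (x \<bullet> x)"
    using assms
  proof (induction rule: psd_induct)
    case zero
    then show ?case by (simp add: trace_def)
  next
    case (add_outer B w)
    then show ?case using hdot_Cauchy_Schwarz[of w x]
      by (simp add: trace_add trace_outer qf_outer distrib_right)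
  qed
qed

lemma norm_mat_vec_le: "norm (A *v x) \<le> op_norm A * norm x"
  unfolding op_norm_eq by (rule onorm) simp

lemma op_norm_eq_0D:
  assumes "op_norm A = 0"
  shows "A = 0"
proof -
  have "A *v x = 0 *v x" for x using norm_mat_vec_le[of A x] assms by simp
  then show ?thesis unfolding matrix_eq by blast
qed

lemma psd_trace_nonneg: "psd A \<Longrightarrow> 0 \<le> Re (trace A)"
  using op_norm_le_trace[of A] op_norm_nonneg[of A] by linarith

lemma psd_trace_eq_0D: "psd A \<Longrightarrow> Re (trace A) \<le> 0 \<Longrightarrow> A = 0"
  using op_norm_le_trace[of A] op_norm_nonneg[of A] by (intro op_norm_eq_0D) linarith

section \<open>States and the order between them\<close>

lemma DO_psd: "\<rho> \<in> DO \<Longrightarrow> psd \<rho>"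
  by (simp add: DO_def)

lemma DO_op_norm_pos: "\<rho> \<in> DO \<Longrightarrow> 0 < op_norm \<rho>"
  using op_norm_eq_0D[of \<rho>] op_norm_nonneg[of \<rho>] by (fastforce simp: DO_def trace_def less_le)

lemma DO_op_norm_le_1: "\<rho> \<in> DO \<Longrightarrow> op_norm \<rho> \<le> 1"
  using op_norm_le_trace[of \<rho>] by (simp add: DO_def)

lemma qpe_le_iff:
  "qpe_le \<rho> \<sigma> \<longleftrightarrow> \<rho> \<in> DO \<and> \<sigma> \<in> DO \<and> (\<forall>x. op_norm \<rho> * qf \<sigma> x \<le> op_norm \<sigma> * qf \<rho> x)"
  by (auto simp: qpe_le_def DO_def psd_iff)

lemma qpe_le_refl: "\<rho> \<in> DO \<Longrightarrow> qpe_le \<rho> \<rho>"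
  by (simp add: qpe_le_iff)

lemma qpe_le_trans:
  assumes "qpe_le \<rho> \<sigma>" "qpe_le \<sigma> \<tau>"
  shows "qpe_le \<rho> \<tau>"
proof -
  let ?r = "op_norm \<rho>" and ?s = "op_norm \<sigma>" and ?t = "op_norm \<tau>"
  have "?r * qf \<tau> x \<le> ?t * qf \<rho> x" for x
  proof -
    have s: "?s > 0" using assms by (simp add: qpe_le_def DO_op_norm_pos)
    have "?s * (?r * qf \<tau> x) = ?r * (?s * qf \<tau> x)" by simp
    also have "\<dots> \<le> ?r * (?t * qf \<sigma> x)"
      using assms by (intro mult_left_mono op_norm_nonneg) (simp add: qpe_le_iff)
    also have "\<dots> = ?t * (?r * qf \<sigma> x)" by simp
    also have "\<dots> \<le> ?t * (?s * qf \<rho> x)"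
      using assms by (intro mult_left_mono op_norm_nonneg) (simp add: qpe_le_iff)
    also have "\<dots> = ?s * (?t * qf \<rho> x)" by simp
    finally show ?thesis using s by simp
  qed
  then show ?thesis using assms by (simp add: qpe_le_iff)
qed

lemma qpe_le_op_norm_mono:
  assumes "qpe_le \<rho> \<sigma>"
  shows "op_norm \<rho> \<le> op_norm \<sigma>"
  using assms psd_trace_nonneg[of "op_norm \<sigma> *\<^sub>R \<rho> - op_norm \<rho> *\<^sub>R \<sigma>"]
  by (simp add: qpe_le_def DO_def trace_diff trace_scaleR)

text \<open>The positive difference that defines the order has trace
  \<open>op_norm \<sigma> - op_norm \<rho>\<close>. When that is not positive the difference is
  zero, the two norms agree, and they cancel. Antisymmetry and the maximality of isometries both
  rest on this.\<close>

lemma qpe_le_eqI: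
  assumes "qpe_le \<rho> \<sigma>" "op_norm \<sigma> \<le> op_norm \<rho>"
  shows "\<rho> = \<sigma>"
proof -
  have "op_norm \<sigma> *\<^sub>R \<rho> - op_norm \<rho> *\<^sub>R \<sigma> = 0"
    using assms by (intro psd_trace_eq_0D) (auto simp: qpe_le_def DO_def trace_diff trace_scaleR)
  moreover have "op_norm \<sigma> = op_norm \<rho>" using qpe_le_op_norm_mono[OF assms(1)] assms(2) by simp
  moreover have "op_norm \<rho> > 0" using assms(1) by (simp add: qpe_le_def DO_op_norm_pos)
  ultimately show ?thesis by simp
qed

lemma DO_convex:
  assumes "\<rho> \<in> DO" "\<sigma> \<in> DO" "0 \<le> t" "t \<le> 1"
  shows "(1 - t) *\<^sub>R \<rho> + t *\<^sub>R \<sigma> \<in> DO"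
  using assms by (simp add: DO_def psd_add psd_scaleR trace_add trace_scaleR
      flip: scaleR_left_distrib)

text \<open>A top eigenvector of \<open>\<sigma>\<close> is one of \<open>\<rho>\<close>.\<close>

lemma op_norm_convex:
  assumes le: "qpe_le \<rho> \<sigma>" and t: "0 \<le> t" "t \<le> 1"
  shows "op_norm ((1 - t) *\<^sub>R \<rho> + t *\<^sub>R \<sigma>) = (1 - t) * op_norm \<rho> + t * op_norm \<sigma>"
proof -
  have DO: "\<rho> \<in> DO" "\<sigma> \<in> DO" using le by (auto simp: qpe_le_def)
  obtain v where v: "norm v = 1" "qf \<sigma> v = op_norm \<sigma>"
    using psd_top_eigenvector[OF DO_psd[OF DO(2)]] by metis
  have "op_norm \<rho> * op_norm \<sigma> \<le> op_norm \<sigma> * qf \<rho> v"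
    using le v(2) unfolding qpe_le_iff by metis
  then have \<rho>v: "op_norm \<rho> \<le> qf \<rho> v"
    using DO_op_norm_pos[OF DO(2)] by (simp add: mult.commute)
  show ?thesis
  proof (rule op_norm_eqI)
    show "psd ((1 - t) *\<^sub>R \<rho> + t *\<^sub>R \<sigma>)" using DO_convex[OF DO t] by (rule DO_psd)
    show "v \<noteq> 0" using v(1) by auto
    show "((1 - t) * op_norm \<rho> + t * op_norm \<sigma>) * (v \<bullet> v) \<le> qf ((1 - t) *\<^sub>R \<rho> + t *\<^sub>R \<sigma>) v"
      using v mult_left_mono[OF \<rho>v, of "1 - t"] t by (simp add: dot_square_norm)
    show "qf ((1 - t) *\<^sub>R \<rho> + t *\<^sub>R \<sigma>) x \<le> ((1 - t) * op_norm \<rho> + t * op_norm \<sigma>) * (x \<bullet> x)" for x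
      using mult_left_mono[OF qf_le_op_norm[of \<rho> x], of "1 - t"]
        mult_left_mono[OF qf_le_op_norm[of \<sigma> x], of t] t
      by (simp add: algebra_simps)
  qed
qed

text \<open>As the norm is affine on the segment, the two differences to be tested are
  \<open>t\<close> and \<open>1 - t\<close> times \<open>op_norm \<sigma> *\<^sub>R \<rho> - op_norm
  \<rho> *\<^sub>R \<sigma>\<close>.\<close>

lemma qpe_le_convex:
  assumes le: "qpe_le \<rho> \<sigma>" and t: "0 \<le> t" "t \<le> 1"
  shows "qpe_le \<rho> ((1 - t) *\<^sub>R \<rho> + t *\<^sub>R \<sigma>)" "qpe_le ((1 - t) *\<^sub>R \<rho> + t *\<^sub>R \<sigma>) \<sigma>"
proof -
  have DO: "\<rho> \<in> DO" "\<sigma> \<in> DO" using le by (auto simp: qpe_le_def)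
  have q: "op_norm \<rho> * qf \<sigma> x \<le> op_norm \<sigma> * qf \<rho> x" for x using le by (simp add: qpe_le_iff)
  show "qpe_le \<rho> ((1 - t) *\<^sub>R \<rho> + t *\<^sub>R \<sigma>)"
    unfolding qpe_le_iff op_norm_convex[OF assms]
    using DO DO_convex[OF DO t] mult_left_mono[OF q, of t] t
    by (simp add: algebra_simps)
  show "qpe_le ((1 - t) *\<^sub>R \<rho> + t *\<^sub>R \<sigma>) \<sigma>"
    unfolding qpe_le_iff op_norm_convex[OF assms]
    using DO DO_convex[OF DO t] mult_left_mono[OF q, of "1 - t"] t
    by (simp add: algebra_simps)
qed

lemma bounded_bilinear_mat_vec: "bounded_bilinear (\<lambda>(A::complex^'n^'m) x. A *v x)"
  unfolding bilinear_conv_bounded_bilinear[symmetric] bilinear_def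
  by (auto intro!: linearI simp: matrix_vector_mult_add_rdistrib scaleR_mat_vec)

text \<open>The triangle inequality and the bound by a multiple of the Euclidean norm make
  \<open>op_norm\<close> Lipschitz.\<close>

lemma continuous_on_op_norm: "continuous_on (S :: (complex^'n^'n) set) op_norm"
proof -
  obtain K where K: "K > 0" "\<And>(A::complex^'n^'n) x. norm (A *v x) \<le> norm A * norm x * K"
    using bounded_bilinear.pos_bounded[OF bounded_bilinear_mat_vec] by metis
  have le: "op_norm A \<le> K * norm A" for A :: "complex^'n^'n"
    unfolding op_norm_eq using K(2) by (intro onorm_le) (simp add: mult_ac)
  have tri: "op_norm A \<le> op_norm B + op_norm (A - B)" for A B :: "complex^'n^'n"
  proof -
    have "(*v) A = (\<lambda>x. B *v x + (A - B) *v x)"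
      by (simp add: fun_eq_iff matrix_vector_mult_diff_rdistrib)
    then show ?thesis unfolding op_norm_eq by (metis onorm_triangle matrix_vector_mul_bounded_linear)
  qed
  have "\<bar>op_norm A - op_norm B\<bar> \<le> K * dist A B" for A B :: "complex^'n^'n"
    using tri[of A B] tri[of B A] le[of "A - B"] le[of "B - A"]
    by (simp add: dist_norm norm_minus_commute abs_le_iff)
  then have "K-lipschitz_on S op_norm"
    using K(1) by (intro lipschitz_onI) (auto simp: dist_real_def)
  then show ?thesis by (rule lipschitz_on_continuous_on)
qed

section \<open>Choi states\<close>

lemma sum_swap_pairs:
  "(\<Sum>a\<in>A. \<Sum>b\<in>B. \<Sum>p\<in>P. \<Sum>q\<in>Q. f a b p q) =
      (\<Sum>p\<in>P. \<Sum>q\<in>Q. \<Sum>a\<in>A. \<Sum>b\<in>B. f a b p q)"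
proof -
  have "(\<Sum>a\<in>A. \<Sum>b\<in>B. \<Sum>p\<in>P. \<Sum>q\<in>Q. f a b p q) =
      (\<Sum>a\<in>A. \<Sum>p\<in>P. \<Sum>b\<in>B. \<Sum>q\<in>Q. f a b p q)"
    by (rule sum.cong[OF refl], rule sum.swap)
  also have "\<dots> = (\<Sum>p\<in>P. \<Sum>a\<in>A. \<Sum>b\<in>B. \<Sum>q\<in>Q. f a b p q)"
    by (rule sum.swap)
  also have "\<dots> = (\<Sum>p\<in>P. \<Sum>a\<in>A. \<Sum>q\<in>Q. \<Sum>b\<in>B. f a b p q)"
    by (rule sum.cong[OF refl], rule sum.cong[OF refl], rule sum.swap)
  also have "\<dots> = (\<Sum>p\<in>P. \<Sum>q\<in>Q. \<Sum>a\<in>A. \<Sum>b\<in>B. f a b p q)"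
    by (rule sum.cong[OF refl], rule sum.swap)
  finally show ?thesis .
qed

lemma sum_UNIV_prod: "(\<Sum>x\<in>UNIV. f x) = (\<Sum>i\<in>UNIV. \<Sum>a\<in>UNIV. f (i, a))"
  unfolding sum.cartesian_product UNIV_Times_UNIV by (simp add: case_prod_eta)

lemma mscale_nth [simp]: "mscale c A $ i $ j = c * A $ i $ j"
  by (simp add: mscale_def)

lemma scaleR_complex: "c *\<^sub>R z = of_real c * z" for z :: complex
  by (rule scaleR_conv_of_real)

lemma mat_unit_nth: "mat_unit i j $ p $ q = (if p = i \<and> q = j then 1 else 0)"
  by (simp add: mat_unit_def axis_def)

lemma kron_nth [simp]: "kron A B $ (i, p) $ (j, q) = A $ i $ j * B $ p $ q"
  by (simp add: kron_def)

lemma sum_delta_mult: "(\<Sum>i\<in>UNIV. (if i = k then 1 else 0) * f i) = (f k :: complex)"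
  "(\<Sum>i\<in>UNIV. (if k = i then 1 else 0) * f i) = (f k :: complex)" for k :: "'a::finite"
  by (simp_all add: if_distrib[of "\<lambda>c. c * _"] cong: if_cong)

lemma sum_mat_unit: "(\<Sum>p\<in>UNIV. \<Sum>q\<in>UNIV. mat_unit i j $ p $ q * f p q) = f i j"
proof -
  have "mat_unit i j $ p $ q * f p q =
      (if p = i then 1 else 0) * ((if q = j then 1 else 0) * f p q)" for p q
    by (simp add: mat_unit_nth)
  then show ?thesis by (simp only: sum_delta_mult flip: sum_distrib_left)
qed

lemma trace_mat_unit: "trace (mat_unit i j) = (if i = j then 1 else 0)"
proof -
  have "mat_unit i j $ p $ p = (if p = i then 1 else 0) * (if p = j then 1 else 0)" for p
    by (simp add: mat_unit_nth)
  then show ?thesis by (simp only: trace_def sum_delta_mult)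
qed

lemma trace_mscale: "trace (mscale c A) = c * trace A"
  by (simp add: trace_def sum_distrib_left)

lemma mat_linearI:
  assumes "\<And>A B. \<Phi> (A + B) = \<Phi> A + \<Phi> B" "\<And>c A. \<Phi> (mscale c A) = mscale c (\<Phi> A)"
  shows "Vector_Spaces.linear mscale mscale \<Phi>"
proof -
  interpret a: vector_space "mscale :: _ \<Rightarrow> complex^'a^'b \<Rightarrow> _" by (rule vector_space_mscale)
  interpret b: vector_space "mscale :: _ \<Rightarrow> complex^'c^'d \<Rightarrow> _" by (rule vector_space_mscale)
  show ?thesis by unfold_locales (use assms in auto)
qed

lemma mat_linear_expand:
  assumes "Vector_Spaces.linear mscale mscale \<Phi>"
  shows "\<Phi> A = (\<Sum>i\<in>UNIV. \<Sum>j\<in>UNIV. mscale (A $ i $ j) (\<Phi> (mat_unit i j)))"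
proof -
  interpret F: Vector_Spaces.linear mscale mscale \<Phi> by fact
  have "(\<Sum>i\<in>UNIV. \<Sum>j\<in>UNIV. A $ i $ j * mat_unit i j $ p $ q) = A $ p $ q" for p q
  proof -
    have "A $ i $ j * mat_unit i j $ p $ q = mat_unit p q $ i $ j * A $ i $ j" for i j
      by (simp add: mat_unit_nth)
    then show ?thesis by (simp only: sum_mat_unit)
  qed
  then have "A = (\<Sum>i\<in>UNIV. \<Sum>j\<in>UNIV. mscale (A $ i $ j) (mat_unit i j))"
    by (simp add: vec_eq_iff)
  then have "\<Phi> A = \<Phi> (\<Sum>i\<in>UNIV. \<Sum>j\<in>UNIV. mscale (A $ i $ j) (mat_unit i j))" by simp
  then show ?thesis by (simp only: F.sum F.scale)
qed

lemma mat_linear_sum_scaleR: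
  assumes "Vector_Spaces.linear mscale mscale \<Phi>" "Vector_Spaces.linear mscale mscale \<Psi>"
  shows "Vector_Spaces.linear mscale mscale (\<lambda>A. c *\<^sub>R \<Phi> A + d *\<^sub>R \<Psi> A)"
proof -
  interpret F: Vector_Spaces.linear mscale mscale \<Phi> by fact
  interpret G: Vector_Spaces.linear mscale mscale \<Psi> by fact
  show ?thesis
    by (rule mat_linearI)
      (simp_all add: F.add G.add F.scale G.scale vec_eq_iff algebra_simps)
qed

section \<open>Channels and the matrices that represent them\<close>

definition choi_set :: "(complex^('n::finite \<times> 'k::finite)^('n \<times> 'k)) set" where
  "choi_set = {J. psd J \<and> (\<forall>i j. (\<Sum>a\<in>UNIV. J $ (i, a) $ (j, a)) =
      (if i = j then 1 / of_nat CARD('n) else 0))}"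

text \<open>Inverse of \<open>choi_state\<close> on linear maps; the factor
  \<open>of_nat CARD('n)\<close> undoes the normalisation.\<close>

definition choi_map :: "complex^('n::finite \<times> 'k::finite)^('n \<times> 'k) \<Rightarrow> complex^'n^'n \<Rightarrow> complex^'k^'k" where
  "choi_map J A = (\<chi> a b. of_nat CARD('n) * (\<Sum>i\<in>UNIV. \<Sum>j\<in>UNIV. A $ i $ j * J $ (i, a) $ (j, b)))"

lemma choi_state_nth:
  fixes \<Phi> :: "complex^'n^'n \<Rightarrow> complex^'k^'k"
  shows "choi_state \<Phi> $ (i, a) $ (j, b) = \<Phi> (mat_unit i j) $ a $ b / of_nat CARD('n)"
proof -
  have "(\<Sum>p\<in>UNIV. \<Sum>q\<in>UNIV. mat_unit p q $ i $ j * \<Phi> (mat_unit p q) $ a $ b) =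
      (\<Sum>p\<in>UNIV. \<Sum>q\<in>UNIV. mat_unit i j $ p $ q * \<Phi> (mat_unit p q) $ a $ b)"
    by (intro sum.cong) (auto simp: mat_unit_nth)
  then have "(\<Sum>p\<in>UNIV. \<Sum>q\<in>UNIV. kron (mat_unit p q) (\<Phi> (mat_unit p q))) $ (i, a) $ (j, b) =
      \<Phi> (mat_unit i j) $ a $ b"
    by (simp add: sum_mat_unit)
  then show ?thesis by (simp add: choi_state_def scaleR_complex)
qed

lemma choi_eqI:
  assumes "\<And>i a j b. J $ (i, a) $ (j, b) = K $ (i, a) $ (j, b)"
  shows "J = K"
  using assms by (simp add: vec_eq_iff split_paired_all)

lemma choi_state_choi_map: "choi_state (choi_map J) = J"
  by (rule choi_eqI) (simp add: choi_state_nth choi_map_def sum_mat_unit)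

lemma choi_map_choi_state:
  assumes "Vector_Spaces.linear mscale mscale \<Phi>"
  shows "choi_map (choi_state \<Phi>) = \<Phi>"
proof
  fix A
  show "choi_map (choi_state \<Phi>) A = \<Phi> A"
    unfolding mat_linear_expand[OF assms, of A]
    by (simp add: vec_eq_iff choi_map_def choi_state_nth sum_distrib_left)
qed

lemma linear_choi_map: "Vector_Spaces.linear mscale mscale (choi_map J)"
  by (rule mat_linearI)
    (simp_all add: vec_eq_iff choi_map_def algebra_simps sum.distrib sum_distrib_left)

lemma hdot_mat_unit: "hdot x (mat_unit i j *v y) = cnj (x $ i) * y $ j"
proof -
  have "hdot x (mat_unit i j *v y) =
      (\<Sum>p\<in>UNIV. \<Sum>q\<in>UNIV. mat_unit i j $ p $ q * (cnj (x $ p) * y $ q))"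
    unfolding hdot_mat_eq by (simp add: mult_ac)
  then show ?thesis by (simp add: sum_mat_unit)
qed

text \<open>Complete positivity is applied to the block matrix of all matrix units, the unnormalised
  maximally entangled state, whose form is \<open>cnj s * s\<close>. The bijection \<open>f\<close>
  is there because ancilla blocks are numbered by naturals.\<close>

lemma psd_choi_state:
  fixes \<Phi> :: "complex^'n^'n \<Rightarrow> complex^'k^'k"
  assumes "completely_positive \<Phi>"
  shows "psd (choi_state \<Phi>)"
  unfolding psd_def
proof
  fix x :: "complex^('n \<times> 'k)"
  define N where "N = CARD('n)"
  obtain f where f: "bij_betw f {..<N} (UNIV :: 'n set)"
    using ex_bij_betw_nat_finite[of "UNIV :: 'n set"] by (auto simp: N_def lessThan_atLeast0)
  have "psd_block N (\<lambda>i j. mat_unit (f i) (f j))"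
    unfolding psd_block_def
  proof
    fix y :: "nat \<Rightarrow> complex^'n"
    define s where "s = (\<Sum>j<N. y j $ f j)"
    have "(\<Sum>i<N. \<Sum>j<N. hdot (y i) (mat_unit (f i) (f j) *v y j)) = cnj s * s"
      by (simp add: hdot_mat_unit s_def sum_product)
    also have "\<dots> = of_real ((cmod s)\<^sup>2)" unfolding complex_norm_square by (rule mult.commute)
    finally show "(\<Sum>i<N. \<Sum>j<N. hdot (y i) (mat_unit (f i) (f j) *v y j)) \<in> \<real>\<^sub>\<ge>\<^sub>0" by simp
  qed
  then have "psd_block N (\<lambda>i j. \<Phi> (mat_unit (f i) (f j)))"
    using assms unfolding completely_positive_def by metis
  \<comment> \<open>The test vectors are the slices of \<open>x\<close> with fixed first
    index.\<close>
  then have "(\<Sum>i<N. \<Sum>j<N. hdot (\<chi> a. x $ (f i, a))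
      (\<Phi> (mat_unit (f i) (f j)) *v (\<chi> a. x $ (f j, a)))) \<in> \<real>\<^sub>\<ge>\<^sub>0" (is "?S \<in> _")
    unfolding psd_block_def by (rule spec[of _ "\<lambda>i. \<chi> a. x $ (f i, a)"])
  moreover have "?S = (\<Sum>i\<in>UNIV. \<Sum>j\<in>UNIV. hdot (\<chi> a. x $ (i, a))
      (\<Phi> (mat_unit i j) *v (\<chi> a. x $ (j, a))))"
    by (simp add: sum.reindex_bij_betw[OF f, of "\<lambda>j. hdot (\<chi> a. x $ (_, a))
          (\<Phi> (mat_unit _ j) *v (\<chi> a. x $ (j, a)))"]
        sum.reindex_bij_betw[OF f, of "\<lambda>i. \<Sum>j\<in>UNIV. hdot (\<chi> a. x $ (i, a))
          (\<Phi> (mat_unit i j) *v (\<chi> a. x $ (j, a)))"])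
  moreover have "hdot x (choi_state \<Phi> *v x) = (1 / of_nat N) *
      (\<Sum>i\<in>UNIV. \<Sum>j\<in>UNIV. hdot (\<chi> a. x $ (i, a)) (\<Phi> (mat_unit i j) *v (\<chi> a. x $ (j, a))))"
    unfolding hdot_mat_eq
    by (simp add: sum_UNIV_prod choi_state_nth N_def sum.swap[of _ "UNIV :: 'n set" "UNIV :: 'k set"]
        flip: sum_divide_distrib)
  moreover have "(1 / of_nat N :: complex) \<in> \<real>\<^sub>\<ge>\<^sub>0" by (simp add: complex_nonneg_Reals_iff)
  ultimately show "hdot x (choi_state \<Phi> *v x) \<in> \<real>\<^sub>\<ge>\<^sub>0" by (simp only: nonneg_Reals_mult_I)
qed

text \<open>A rank-one Choi matrix amounts to a single Kraus operator: up to the factor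
  \<open>of_nat CARD('n)\<close> the map sends X to K X K^dagger, where K has the entry
  \<open>w $ (p, a)\<close> in row \<open>a\<close> and column \<open>p\<close>. The vectors on the
  right are K^dagger x and K^dagger y.\<close>

lemma hdot_choi_map_outer:
  fixes w :: "complex^('n::finite \<times> 'k::finite)"
  shows "hdot x (choi_map (outer w) X *v y) = of_nat CARD('n) *
    hdot (\<chi> p. \<Sum>a\<in>UNIV. cnj (w $ (p, a)) * x $ a) (X *v (\<chi> q. \<Sum>b\<in>UNIV. cnj (w $ (q, b)) * y $ b))"
proof -
  let ?N = "of_nat CARD('n) :: complex"
  let ?f = "\<lambda>a b p q. ?N * (cnj (x $ a) * (X $ p $ q * (w $ (p, a) * cnj (w $ (q, b)))) * y $ b)"
  have "hdot x (choi_map (outer w) X *v y) =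
      (\<Sum>a\<in>UNIV. \<Sum>b\<in>UNIV. \<Sum>p\<in>UNIV. \<Sum>q\<in>UNIV. ?f a b p q)"
    unfolding hdot_mat_eq
    by (simp add: choi_map_def outer_def sum_distrib_left sum_distrib_right mult_ac)
  also have "\<dots> = (\<Sum>p\<in>UNIV. \<Sum>q\<in>UNIV. \<Sum>a\<in>UNIV. \<Sum>b\<in>UNIV. ?f a b p q)"
    by (rule sum_swap_pairs)
  also have "\<dots> = ?N * hdot (\<chi> p. \<Sum>a\<in>UNIV. cnj (w $ (p, a)) * x $ a)
      (X *v (\<chi> q. \<Sum>b\<in>UNIV. cnj (w $ (q, b)) * y $ b))"
    unfolding hdot_mat_eq
    by (simp add: sum_product sum_distrib_left sum_distrib_right mult_ac)
  finally show ?thesis .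
qed

lemma hdot_add_mat: "hdot x ((A + B) *v y) = hdot x (A *v y) + hdot x (B *v y)"
  by (simp add: matrix_vector_mult_add_rdistrib hdot_add_right)

lemma choi_map_add: "choi_map (J + K) A = choi_map J A + choi_map K A"
  by (simp add: choi_map_def vec_eq_iff algebra_simps sum.distrib)

text \<open>Each rank-one piece of \<open>J\<close> contributes a Kraus map, whose adjoint operator
  carries the test vectors \<open>x i\<close> to test vectors \<open>z i\<close> for the original
  block matrix, whatever the ancilla size \<open>m\<close>.\<close>

lemma completely_positive_choi_map:
  fixes J :: "complex^('n::finite \<times> 'k::finite)^('n \<times> 'k)"
  assumes "psd J"
  shows "completely_positive (choi_map J)"
  unfolding completely_positive_def
proof (intro allI impI)
  fix m and B :: "nat \<Rightarrow> nat \<Rightarrow> complex^'n^'n"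
  assume B: "psd_block m B"
  show "psd_block m (\<lambda>i j. choi_map J (B i j))"
    using assms
  proof (induction rule: psd_induct)
    case zero
    have "hdot x (choi_map 0 A *v y) = 0" for x y :: "complex^'k" and A :: "complex^'n^'n"
      by (simp add: choi_map_def hdot_mat_eq)
    then show ?case by (simp add: psd_block_def)
  next
    case (add_outer J w)
    have "(\<Sum>i<m. \<Sum>j<m. hdot (x i) (choi_map (outer w) (B i j) *v x j)) \<in> \<real>\<^sub>\<ge>\<^sub>0"
      for x :: "nat \<Rightarrow> complex^'k"
    proof -
      define z where "z i = (\<chi> p. \<Sum>a\<in>UNIV. cnj (w $ (p, a)) * x i $ a)" for i
      have "(\<Sum>i<m. \<Sum>j<m. hdot (z i) (B i j *v z j)) \<in> \<real>\<^sub>\<ge>\<^sub>0"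
        using B by (simp add: psd_block_def)
      then show ?thesis
        unfolding hdot_choi_map_outer z_def[symmetric] sum_distrib_left[symmetric]
        by (intro nonneg_Reals_mult_I) auto
    qed
    then show ?case
      using add_outer.IH
      by (simp add: psd_block_def choi_map_add hdot_add_mat sum.distrib nonneg_Reals_add_I)
  qed
qed

text \<open>By linearity trace preservation is a condition on matrix units, and it becomes the
  marginal condition after division by \<open>of_nat CARD('n)\<close>. The two implications for
  positivity meet through \<open>choi_map_choi_state\<close>.\<close>

lemma CPTP_iff:
  fixes \<Phi> :: "complex^'n^'n \<Rightarrow> complex^'k^'k"
  shows "\<Phi> \<in> CPTP \<longleftrightarrow> Vector_Spaces.linear mscale mscale \<Phi> \<and> choi_state \<Phi> \<in> choi_set"
proof (cases "Vector_Spaces.linear mscale mscale \<Phi>")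
  case lin: True
  have tr: "trace (\<Phi> A) = (\<Sum>i\<in>UNIV. \<Sum>j\<in>UNIV. A $ i $ j * trace (\<Phi> (mat_unit i j)))" for A
    unfolding mat_linear_expand[OF lin, of A] trace_def
    by (simp add: sum_distrib_left sum.swap[of _ "UNIV :: 'k set" "UNIV :: 'n set"])
  have "(\<forall>A. trace (\<Phi> A) = trace A) \<longleftrightarrow>
      (\<forall>i j. trace (\<Phi> (mat_unit i j)) = (if i = j then 1 else 0))"
  proof (intro iffI allI)
    fix A :: "complex^'n^'n" assume *: "\<forall>i j. trace (\<Phi> (mat_unit i j)) = (if i = j then 1 else 0)"
    have "A $ i $ j * (if i = j then 1 else 0) = (if i = j then 1 else 0) * A $ i $ j" for i j by (cases "i = j") simp_all
    then show "trace (\<Phi> A) = trace A"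
      unfolding tr[of A] by (simp only: * sum_delta_mult) (simp add: trace_def)
  qed (simp add: trace_mat_unit)
  also have "\<dots> \<longleftrightarrow> (\<forall>i j. (\<Sum>a\<in>UNIV. choi_state \<Phi> $ (i, a) $ (j, a)) =
      (if i = j then 1 / of_nat CARD('n) else 0))"
  proof -
    have "x = (if P then 1 else 0) \<longleftrightarrow> x / of_nat CARD('n) = (if P then 1 / of_nat CARD('n) else 0)"
      for x :: complex and P by (simp add: field_simps)
    then show ?thesis by (simp only: choi_state_nth trace_def sum_divide_distrib)
  qed
  finally have "\<Phi> \<in> CPTP \<longleftrightarrow> completely_positive \<Phi> \<and> (\<forall>i j.
      (\<Sum>a\<in>UNIV. choi_state \<Phi> $ (i, a) $ (j, a)) = (if i = j then 1 / of_nat CARD('n) else 0))"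
    using lin by (simp add: CPTP_def)
  moreover have "completely_positive \<Phi> \<longleftrightarrow> psd (choi_state \<Phi>)"
    using psd_choi_state[of \<Phi>] completely_positive_choi_map[of "choi_state \<Phi>"]
    by (auto simp: choi_map_choi_state[OF lin])
  ultimately show ?thesis using lin by (simp add: choi_set_def)
qed (simp add: CPTP_def)

text \<open>Through this bijection order questions about channels become questions about a compact
  convex set of matrices.\<close>

lemma bij_betw_choi_state: "bij_betw choi_state CPTP choi_set"
  by (rule bij_betw_byWitness[where f' = choi_map])
    (auto simp: CPTP_iff choi_map_choi_state choi_state_choi_map linear_choi_map)

lemma choi_set_psd: "J \<in> choi_set \<Longrightarrow> psd J"
  by (simp add: choi_set_def)

lemma choi_set_subset_DO: "choi_set \<subseteq> DO"
  by (auto simp: choi_set_def DO_def trace_def sum_UNIV_prod)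

lemma choi_set_convex:
  assumes "J \<in> choi_set" "K \<in> choi_set" "0 \<le> t" "t \<le> 1"
  shows "(1 - t) *\<^sub>R J + t *\<^sub>R K \<in> choi_set"
proof -
  have "(\<Sum>a\<in>UNIV. ((1 - t) *\<^sub>R J + t *\<^sub>R K) $ (i, a) $ (j, a)) =
      (1 - t) *\<^sub>R (\<Sum>a\<in>UNIV. J $ (i, a) $ (j, a)) + t *\<^sub>R (\<Sum>a\<in>UNIV. K $ (i, a) $ (j, a))" for i j
    by (simp add: sum.distrib scaleR_sum_right)
  then show ?thesis
    using assms by (simp add: choi_set_def psd_add psd_scaleR flip: scaleR_left_distrib)
qed

lemma choi_state_convex:
  "choi_state (\<lambda>A. (1 - t) *\<^sub>R \<Phi> A + t *\<^sub>R \<Psi> A) = (1 - t) *\<^sub>R choi_state \<Phi> + t *\<^sub>R choi_state \<Psi>"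
  by (rule choi_eqI) (simp add: choi_state_nth scaleR_complex add_divide_distrib)

lemma linear_depolarizing: "Vector_Spaces.linear mscale mscale depolarizing"
  by (rule mat_linearI)
    (simp_all add: depolarizing_def vec_eq_iff trace_add trace_mscale add_divide_distrib distrib_right)

lemma choi_state_depolarizing:
  "choi_state (depolarizing :: complex^'n^'n \<Rightarrow> complex^'k^'k) = (1 / real (CARD('n) * CARD('k))) *\<^sub>R mat 1"
proof (rule choi_eqI)
  fix i j :: 'n and a b :: 'k
  show "choi_state (depolarizing :: complex^'n^'n \<Rightarrow> complex^'k^'k) $ (i, a) $ (j, b) =
      ((1 / real (CARD('n) * CARD('k))) *\<^sub>R mat 1) $ (i, a) $ (j, b)"
    by (auto simp: choi_state_nth depolarizing_def trace_mat_unit mat_def scaleR_complex)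
qed

section \<open>Tensor products, isometries and convexity\<close>

lemma kron_simps:
  "kron (A + B) C = kron A C + kron B C"
  "kron (A - B) C = kron A C - kron B C"
  "kron A (C + D) = kron A C + kron A D"
  "kron A (C - D) = kron A C - kron A D"
  "kron (c *\<^sub>R A) C = c *\<^sub>R kron A C"
  "kron A (c *\<^sub>R C) = c *\<^sub>R kron A C"
  "kron 0 C = 0"
  by (simp_all add: vec_eq_iff kron_def algebra_simps)

lemma kron_mat1: "kron (mat 1) (mat 1) = mat 1"
  by (auto simp: vec_eq_iff kron_def mat_def)

lemma hdot_kron_outer:
  fixes x y :: "complex^('m::finite \<times> 'n::finite)"
  shows "hdot x (kron (outer w) B *v y) = hdot (\<chi> p. \<Sum>i\<in>UNIV. cnj (w $ i) * x $ (i, p))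
    (B *v (\<chi> q. \<Sum>j\<in>UNIV. cnj (w $ j) * y $ (j, q)))"
proof -
  let ?f = "\<lambda>i j p q. cnj (x $ (i, p)) * (w $ i * cnj (w $ j) * B $ p $ q) * y $ (j, q)"
  have "hdot x (kron (outer w) B *v y) =
      (\<Sum>i\<in>UNIV. \<Sum>p\<in>UNIV. \<Sum>j\<in>UNIV. \<Sum>q\<in>UNIV. ?f i j p q)"
    unfolding hdot_mat_eq sum_UNIV_prod by (simp add: outer_def)
  also have "\<dots> = (\<Sum>i\<in>UNIV. \<Sum>j\<in>UNIV. \<Sum>p\<in>UNIV. \<Sum>q\<in>UNIV. ?f i j p q)"
    by (rule sum.cong[OF refl], rule sum.swap)
  also have "\<dots> = (\<Sum>p\<in>UNIV. \<Sum>q\<in>UNIV. \<Sum>i\<in>UNIV. \<Sum>j\<in>UNIV. ?f i j p q)"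
    by (rule sum_swap_pairs)
  also have "\<dots> = hdot (\<chi> p. \<Sum>i\<in>UNIV. cnj (w $ i) * x $ (i, p))
      (B *v (\<chi> q. \<Sum>j\<in>UNIV. cnj (w $ j) * y $ (j, q)))"
    unfolding hdot_mat_eq
    by (simp add: sum_product sum_distrib_left sum_distrib_right mult_ac)
  finally show ?thesis .
qed

text \<open>Additivity in \<open>A\<close> leaves the rank-one case, where contracting the first
  tensor factor with \<open>w\<close> turns the form of \<open>kron (outer w) B\<close> into that of
  \<open>B\<close>.\<close>

lemma psd_kron:
  assumes "psd A" "psd B"
  shows "psd (kron A B)"
  using assms(1)
proof (induction rule: psd_induct)
  case zero
  then show ?case by (simp add: kron_simps psd_zero)
next
  case (add_outer A w)
  have "psd (kron (outer w) B)"
    using assms(2) unfolding psd_def hdot_kron_outer by blast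
  then show ?case using add_outer.IH by (simp add: kron_simps psd_add)
qed

lemma psd_op_norm_diff:
  assumes "psd A"
  shows "psd (op_norm A *\<^sub>R mat 1 - A)"
  using assms qf_le_op_norm[of A] by (simp add: psd_iff)

definition kvec :: "complex^'m \<Rightarrow> complex^'n \<Rightarrow> complex^('m::finite \<times> 'n::finite)" where
  "kvec v w = (\<chi> p. v $ fst p * w $ snd p)"

lemma kron_mat_vec: "kron A B *v kvec v w = kvec (A *v v) (B *v w)"
  by (auto simp: vec_eq_iff matrix_vector_mult_def kvec_def kron_def sum_UNIV_prod sum_product mult_ac)

lemma hdot_kvec: "hdot (kvec v w) (kvec x y) = hdot v x * hdot w y"
  by (simp add: hdot_def kvec_def sum_UNIV_prod sum_product mult_ac)

text \<open>The product of two top eigenvectors attains the value. For the upper bound, ab I - A (x)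
  B equals (aI - A) (x) bI + A (x) (bI - B), a sum of products of positive matrices.\<close>

lemma op_norm_kron:
  assumes A: "psd A" and B: "psd B"
  shows "op_norm (kron A B) = op_norm A * op_norm B"
proof -
  let ?a = "op_norm A" and ?b = "op_norm B"
  obtain v w where v: "norm v = 1" "A *v v = ?a *\<^sub>R v" and w: "norm w = 1" "B *v w = ?b *\<^sub>R w"
    using psd_top_eigenvector[OF A] psd_top_eigenvector[OF B] by metis
  have "hdot v v = 1" "hdot w w = 1" using v w by (simp_all add: hdot_self dot_square_norm)
  then have "hdot (kvec v w) (kvec v w) = 1" by (simp add: hdot_kvec)
  then have vw: "kvec v w \<bullet> kvec v w = 1" by (metis Re_hdot one_complex.sel(1))
  have "kron A B *v kvec v w = (?a * ?b) *\<^sub>R kvec v w"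
    unfolding kron_mat_vec v w by (simp add: vec_eq_iff kvec_def)
  then have ev: "qf (kron A B) (kvec v w) = ?a * ?b" by (simp add: qf_def vw)
  show ?thesis
  proof (rule op_norm_eqI)
    show "psd (kron A B)" using A B by (rule psd_kron)
    show "kvec v w \<noteq> 0" using vw by auto
    show "?a * ?b * (kvec v w \<bullet> kvec v w) \<le> qf (kron A B) (kvec v w)" by (simp add: ev vw)
    fix x
    have "psd (kron (?a *\<^sub>R mat 1 - A) (?b *\<^sub>R mat 1) + kron A (?b *\<^sub>R mat 1 - B))"
      by (intro psd_add psd_kron psd_op_norm_diff psd_scaleR op_norm_nonneg psd_mat1 A B)
    moreover have "kron (?a *\<^sub>R mat 1 - A) (?b *\<^sub>R mat 1) + kron A (?b *\<^sub>R mat 1 - B) =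
        (?a * ?b) *\<^sub>R mat 1 - kron A B"
      by (simp add: kron_simps kron_mat1 algebra_simps)
    ultimately have "0 \<le> qf ((?a * ?b) *\<^sub>R mat 1 - kron A B) x" by (simp only: psd_iff)
    then show "qf (kron A B) x \<le> ?a * ?b * (x \<bullet> x)" by simp
  qed
qed

definition reindex :: "('a \<Rightarrow> 'b) \<Rightarrow> complex^'b^'b \<Rightarrow> complex^'a^'a" where
  "reindex \<pi> A = (\<chi> x y. A $ \<pi> x $ \<pi> y)"

lemma hdot_reindex:
  assumes "bij \<pi>"
  shows "hdot x (reindex \<pi> A *v y) = hdot (\<chi> i. x $ inv \<pi> i) (A *v (\<chi> i. y $ inv \<pi> i))"
proof -
  have "hdot x (reindex \<pi> A *v y) = (\<Sum>i\<in>UNIV. \<Sum>j\<in>UNIV.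
      cnj (x $ inv \<pi> (\<pi> i)) * A $ \<pi> i $ \<pi> j * y $ inv \<pi> (\<pi> j))"
    unfolding hdot_mat_eq using assms by (simp add: reindex_def bij_is_inj)
  also have "\<dots> = (\<Sum>i\<in>UNIV. \<Sum>j\<in>UNIV. cnj (x $ inv \<pi> i) * A $ i $ j * y $ inv \<pi> j)"
    unfolding sum.reindex_bij_betw[OF assms, of "\<lambda>j. cnj (x $ inv \<pi> _) * A $ _ $ j * y $ inv \<pi> j"]
    by (rule sum.reindex_bij_betw[OF assms,
        of "\<lambda>i. \<Sum>j\<in>UNIV. cnj (x $ inv \<pi> i) * A $ i $ j * y $ inv \<pi> j"])
  finally show ?thesis by (simp add: hdot_mat_eq)
qed

lemma qf_reindex: "bij \<pi> \<Longrightarrow> qf (reindex \<pi> A) x = qf A (\<chi> i. x $ inv \<pi> i)"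
  by (simp add: qf_eq_Re hdot_reindex)

lemma psd_reindex: "bij \<pi> \<Longrightarrow> psd A \<Longrightarrow> psd (reindex \<pi> A)"
  by (simp add: psd_def hdot_reindex)

lemma reindex_mat1: "bij \<pi> \<Longrightarrow> reindex \<pi> (mat 1) = mat 1"
  by (auto simp: vec_eq_iff reindex_def mat_def bij_def dest: injD)

text \<open>\<open>reindex\<close> conjugates by a permutation unitary, so quadratic forms and norms
  of vectors are carried over together.\<close>

lemma op_norm_reindex:
  fixes \<pi> :: "'a::finite \<Rightarrow> 'b::finite"
  assumes \<pi>: "bij \<pi>" and A: "psd A"
  shows "op_norm (reindex \<pi> A) = op_norm A"
proof -
  have norm: "(\<chi> i. x $ inv \<pi> i) \<bullet> (\<chi> i. x $ inv \<pi> i) = x \<bullet> x" for x :: "complex^'a"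
    using qf_reindex[OF \<pi>, of "mat 1" x] by (simp add: reindex_mat1[OF \<pi>])
  obtain v where v: "norm v = 1" "qf A v = op_norm A" using psd_top_eigenvector[OF A] by metis
  define u where "u = (\<chi> i. v $ \<pi> i)"
  have uv: "(\<chi> i. u $ inv \<pi> i) = v"
    using \<pi> by (simp add: u_def vec_eq_iff bij_is_surj surj_f_inv_f)
  then have uu: "u \<bullet> u = 1" using norm[of u] v(1) by (simp add: dot_square_norm)
  show ?thesis
  proof (rule op_norm_eqI)
    show "psd (reindex \<pi> A)" using \<pi> A by (rule psd_reindex)
    show "qf (reindex \<pi> A) x \<le> op_norm A * (x \<bullet> x)" for x
      unfolding qf_reindex[OF \<pi>] norm[of x, symmetric] by (rule qf_le_op_norm)
    show "u \<noteq> 0" using uu by auto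
    show "op_norm A * (u \<bullet> u) \<le> qf (reindex \<pi> A) u" by (simp add: uu qf_reindex[OF \<pi>] uv v(2))
  qed
qed

text \<open>A product of Choi states lists two (input, output) pairs, the Choi state of a product
  map lists both inputs before both outputs; this permutation reconciles the two index
  orders.\<close>

definition swap_mid :: "('n \<times> 'm) \<times> ('k \<times> 'l) \<Rightarrow> ('n \<times> 'k) \<times> ('m \<times> 'l)" where
  "swap_mid = (\<lambda>((i, p), (a, c)). ((i, a), (p, c)))"

lemma bij_swap_mid: "bij swap_mid"
  \<comment> \<open>The same formula, at the exchanged types, is the inverse.\<close>
  by (rule o_bij[of swap_mid]) (auto simp: swap_mid_def fun_eq_iff)

lemma linear_tensor_map: "Vector_Spaces.linear mscale mscale (tensor_map \<Phi> \<Psi>)"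
  by (rule mat_linearI)
    (simp_all add: tensor_map_def vec_eq_iff algebra_simps sum.distrib sum_distrib_left)

lemma tensor_map_mat_unit:
  "tensor_map \<Phi> \<Psi> (mat_unit (i, p) (j, q)) = kron (\<Phi> (mat_unit i j)) (\<Psi> (mat_unit p q))"
proof -
  have "mat_unit (i, p) (j, q) $ (i', p') $ (j', q') =
      mat_unit i j $ i' $ j' * mat_unit p q $ p' $ q'" for i' p' j' q'
    by (simp add: mat_unit_nth)
  then show ?thesis
    by (simp add: tensor_map_def vec_eq_iff mult.assoc sum_mat_unit flip: sum_distrib_left)
qed

lemma choi_state_tensor_map:
  fixes \<Phi> :: "complex^'n^'n \<Rightarrow> complex^'k^'k" and \<Psi> :: "complex^'m^'m \<Rightarrow> complex^'l^'l"
  shows "choi_state (tensor_map \<Phi> \<Psi>) = reindex swap_mid (kron (choi_state \<Phi>) (choi_state \<Psi>))"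
  by (rule choi_eqI)
    (auto simp: choi_state_nth tensor_map_mat_unit reindex_def swap_mid_def)

lemma choi_set_kron:
  fixes J :: "complex^('n::finite \<times> 'k::finite)^('n \<times> 'k)"
    and K :: "complex^('m::finite \<times> 'l::finite)^('m \<times> 'l)"
  assumes J: "J \<in> choi_set" and K: "K \<in> choi_set"
  shows "reindex swap_mid (kron J K) \<in> choi_set"
proof -
  have "(\<Sum>a\<in>UNIV. reindex swap_mid (kron J K) $ (x, a) $ (y, a)) =
      (if x = y then 1 / of_nat CARD('n \<times> 'm) else 0)" for x y
  proof -
    obtain i p j q where xy: "x = (i, p)" "y = (j, q)" by (cases x, cases y)
    have "(\<Sum>a\<in>UNIV. reindex swap_mid (kron J K) $ (x, a) $ (y, a)) =
        (\<Sum>a\<in>UNIV. J $ (i, a) $ (j, a)) * (\<Sum>c\<in>UNIV. K $ (p, c) $ (q, c))"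
      by (simp add: xy sum_UNIV_prod reindex_def swap_mid_def sum_product)
    then show ?thesis using J K by (simp add: xy choi_set_def)
  qed
  moreover have "psd (reindex swap_mid (kron J K))"
    using J K by (intro psd_reindex bij_swap_mid psd_kron choi_set_psd)
  ultimately show ?thesis by (simp add: choi_set_def)
qed

lemma tensor_map_CPTP: "\<Phi> \<in> CPTP \<Longrightarrow> \<Psi> \<in> CPTP \<Longrightarrow> tensor_map \<Phi> \<Psi> \<in> CPTP"
  by (simp add: CPTP_iff linear_tensor_map choi_state_tensor_map choi_set_kron)

lemma channel_le_tensor_map:
  assumes CPTP: "\<Phi>\<^sub>1 \<in> CPTP" "\<Psi>\<^sub>1 \<in> CPTP" "\<Phi>\<^sub>2 \<in> CPTP" "\<Psi>\<^sub>2 \<in> CPTP"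
    and le: "channel_le \<Phi>\<^sub>1 \<Psi>\<^sub>1" "channel_le \<Phi>\<^sub>2 \<Psi>\<^sub>2"
  shows "channel_le (tensor_map \<Phi>\<^sub>1 \<Phi>\<^sub>2) (tensor_map \<Psi>\<^sub>1 \<Psi>\<^sub>2)"
proof -
  define R\<^sub>1 S\<^sub>1 R\<^sub>2 S\<^sub>2 where "R\<^sub>1 = choi_state \<Phi>\<^sub>1" and "S\<^sub>1 = choi_state \<Psi>\<^sub>1"
    and "R\<^sub>2 = choi_state \<Phi>\<^sub>2" and "S\<^sub>2 = choi_state \<Psi>\<^sub>2"
  note defs = R\<^sub>1_def S\<^sub>1_def R\<^sub>2_def S\<^sub>2_def
  have psd: "psd R\<^sub>1" "psd S\<^sub>1" "psd R\<^sub>2" "psd S\<^sub>2"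
    using CPTP by (simp_all add: defs CPTP_iff choi_set_psd)
  let ?r1 = "op_norm R\<^sub>1" and ?s1 = "op_norm S\<^sub>1" and ?r2 = "op_norm R\<^sub>2" and ?s2 = "op_norm S\<^sub>2"
  have "psd (?s1 *\<^sub>R R\<^sub>1 - ?r1 *\<^sub>R S\<^sub>1)" "psd (?s2 *\<^sub>R R\<^sub>2 - ?r2 *\<^sub>R S\<^sub>2)"
    using le by (simp_all add: channel_le_def qpe_le_def defs)
  \<comment> \<open>One tensor factor is changed at a time; the mixed terms cancel and leave the
    difference of the two products.\<close>
  then have "psd (kron (?s1 *\<^sub>R R\<^sub>1 - ?r1 *\<^sub>R S\<^sub>1) (?s2 *\<^sub>R R\<^sub>2) +
      kron (?r1 *\<^sub>R S\<^sub>1) (?s2 *\<^sub>R R\<^sub>2 - ?r2 *\<^sub>R S\<^sub>2))"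
    by (intro psd_add psd_kron psd_scaleR op_norm_nonneg psd)
  then have "psd ((?s1 * ?s2) *\<^sub>R kron R\<^sub>1 R\<^sub>2 - (?r1 * ?r2) *\<^sub>R kron S\<^sub>1 S\<^sub>2)"
    by (simp add: kron_simps algebra_simps)
  then have "psd (reindex swap_mid ((?s1 * ?s2) *\<^sub>R kron R\<^sub>1 R\<^sub>2 - (?r1 * ?r2) *\<^sub>R kron S\<^sub>1 S\<^sub>2))"
    by (rule psd_reindex[OF bij_swap_mid])
  moreover have "reindex swap_mid ((?s1 * ?s2) *\<^sub>R kron R\<^sub>1 R\<^sub>2 - (?r1 * ?r2) *\<^sub>R kron S\<^sub>1 S\<^sub>2) =
      (?s1 * ?s2) *\<^sub>R reindex swap_mid (kron R\<^sub>1 R\<^sub>2) - (?r1 * ?r2) *\<^sub>R reindex swap_mid (kron S\<^sub>1 S\<^sub>2)"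
    by (simp add: reindex_def vec_eq_iff)
  moreover have "reindex swap_mid (kron R\<^sub>1 R\<^sub>2) \<in> DO" "reindex swap_mid (kron S\<^sub>1 S\<^sub>2) \<in> DO"
    using CPTP by (auto simp: defs CPTP_iff intro!: subsetD[OF choi_set_subset_DO] choi_set_kron)
  ultimately show ?thesis
    unfolding channel_le_def qpe_le_def choi_state_tensor_map defs[symmetric]
    using psd by (simp add: op_norm_reindex[OF bij_swap_mid] psd_kron op_norm_kron)
qed

section \<open>Bottom element, isometries and mixtures\<close>

lemma depolarizing_CPTP: "(depolarizing :: complex^'n^'n \<Rightarrow> complex^'k^'k) \<in> CPTP"
proof -
  have "(\<Sum>a\<in>(UNIV :: 'k set). mat 1 $ (i, a) $ (j, a)) = (if i = j then of_nat CARD('k) else (0::complex))"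
    for i j :: 'n
    by (simp add: mat_def)
  then show ?thesis
    by (auto simp: CPTP_iff linear_depolarizing choi_state_depolarizing choi_set_def psd_scaleR psd_mat1
        scaleR_complex simp flip: sum_divide_distrib)
qed

lemma op_norm_mat1: "op_norm (mat 1 :: complex^'n^'n) = 1"
  by (rule op_norm_eqI[where v = "axis undefined 1"]) (auto simp: psd_mat1 axis_eq_0_iff)

lemma op_norm_scaleR: "0 \<le> c \<Longrightarrow> op_norm (c *\<^sub>R A) = c * op_norm A"
  by (simp add: op_norm_def scaleR_mat_vec onorm_scaleR)

text \<open>The Choi state of \<open>depolarizing\<close> is a multiple of the identity, so the
  order reduces to the bound of a matrix by its operator norm times the identity.\<close>

lemma depolarizing_le:
  assumes "\<Phi> \<in> CPTP"
  shows "channel_le depolarizing \<Phi>"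
proof -
  have DO: "choi_state depolarizing \<in> DO" "choi_state \<Phi> \<in> DO"
    using assms depolarizing_CPTP choi_set_subset_DO by (auto simp: CPTP_iff)
  show ?thesis
    unfolding channel_le_def qpe_le_iff using DO qf_le_op_norm[of "choi_state \<Phi>"]
    by (simp add: choi_state_depolarizing op_norm_scaleR op_norm_mat1 divide_right_mono)
qed

lemma linear_kraus1: "Vector_Spaces.linear mscale mscale (kraus1 V)"
  by (rule mat_linearI)
    (simp_all add: kraus1_def vec_eq_iff matrix_matrix_mult_def algebra_simps sum.distrib
      sum_distrib_left sum_distrib_right)

text \<open>The vector is \<open>V\<close> flattened, with the normalisation split as a square root
  over the two factors of \<open>outer\<close>. For an isometry this is a pure state.\<close>

lemma choi_state_kraus1:
  fixes V :: "complex^'n^'k"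
  shows "choi_state (kraus1 V) = outer (\<chi> p. V $ snd p $ fst p / of_real (sqrt CARD('n)))"
proof (rule choi_eqI)
  fix i j :: 'n and a b :: 'k
  have "kraus1 V (mat_unit i j) $ a $ b =
      (\<Sum>q\<in>UNIV. \<Sum>p\<in>UNIV. mat_unit i j $ p $ q * (V $ a $ p * cnj (V $ b $ q)))"
    by (simp add: kraus1_def matrix_matrix_mult_def adjoint_mat_def sum_distrib_left sum_distrib_right mult_ac)
  also have "\<dots> = V $ a $ i * cnj (V $ b $ j)"
    by (subst sum.swap) (rule sum_mat_unit)
  finally have "choi_state (kraus1 V) $ (i, a) $ (j, b) = V $ a $ i * cnj (V $ b $ j) / of_nat CARD('n)"
    by (simp add: choi_state_nth)
  moreover have "complex_of_real (sqrt CARD('n)) * complex_of_real (sqrt CARD('n)) = of_nat CARD('n)"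
    by (simp flip: of_real_mult)
  ultimately show "choi_state (kraus1 V) $ (i, a) $ (j, b) =
      outer (\<chi> p. V $ snd p $ fst p / of_real (sqrt CARD('n))) $ (i, a) $ (j, b)"
    by (simp add: outer_def)
qed

lemma kraus1_CPTP:
  fixes V :: "complex^'n^'k"
  assumes "adjoint_mat V ** V = mat 1"
  shows "kraus1 V \<in> CPTP"
proof -
  have "trace (kraus1 V A) = trace A" for A
  proof -
    have "trace (V ** A ** adjoint_mat V) = trace (adjoint_mat V ** (V ** A))"
      by (rule trace_mul_sym)
    then show ?thesis using assms by (simp add: kraus1_def matrix_mul_assoc)
  qed
  moreover have "completely_positive (choi_map (choi_state (kraus1 V)))"
    by (intro completely_positive_choi_map) (simp add: choi_state_kraus1 psd_outer)
  then have "completely_positive (kraus1 V)"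
    by (simp add: choi_map_choi_state linear_kraus1)
  ultimately show ?thesis by (simp add: CPTP_def linear_kraus1)
qed

lemma kraus1_maximal:
  fixes V :: "complex^'n^'k"
  assumes V: "adjoint_mat V ** V = mat 1" and "\<Psi> \<in> CPTP" and le: "channel_le (kraus1 V) \<Psi>"
  shows "\<Psi> = kraus1 V"
proof -
  define w :: "complex^('n \<times> 'k)" where "w = (\<chi> p. V $ snd p $ fst p / of_real (sqrt CARD('n)))"
  have choi: "choi_state (kraus1 V) = outer w" unfolding w_def by (rule choi_state_kraus1)
  have DO: "outer w \<in> DO" "choi_state \<Psi> \<in> DO"
    using le by (simp_all add: channel_le_def qpe_le_def choi)
  then have ww: "w \<bullet> w = 1" by (simp add: DO_def trace_outer)
  then have "1 \<le> op_norm (outer w)"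
    using qf_le_op_norm[of "outer w" w] by (simp add: qf_outer hdot_self)
  then have "outer w = choi_state \<Psi>"
    using le DO_op_norm_le_1[OF DO(2)] by (intro qpe_le_eqI) (auto simp: channel_le_def choi)
  then have "choi_map (choi_state (kraus1 V)) = choi_map (choi_state \<Psi>)" by (simp add: choi)
  then show ?thesis using assms(2) linear_kraus1[of V] by (simp add: choi_map_choi_state CPTP_iff)
qed

lemma CPTP_convex:
  assumes "\<Phi> \<in> CPTP" "\<Psi> \<in> CPTP" "0 \<le> t" "t \<le> 1"
  shows "(\<lambda>A. (1 - t) *\<^sub>R \<Phi> A + t *\<^sub>R \<Psi> A) \<in> CPTP"
  using assms by (simp add: CPTP_iff mat_linear_sum_scaleR choi_state_convex choi_set_convex)

text \<open>The Choi state is affine in the map, so one direction is \<open>qpe_le_convex\<close>;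
  the other is the case \<open>t = 1\<close>.\<close>

lemma channel_le_convex_iff:
  "channel_le \<Phi> \<Psi> \<longleftrightarrow>
     (\<forall>t::real. 0 \<le> t \<and> t \<le> 1 \<longrightarrow>
        channel_le \<Phi> (\<lambda>A. (1 - t) *\<^sub>R \<Phi> A + t *\<^sub>R \<Psi> A) \<and>
        channel_le (\<lambda>A. (1 - t) *\<^sub>R \<Phi> A + t *\<^sub>R \<Psi> A) \<Psi>)"
  unfolding channel_le_def choi_state_convex
proof
  assume "\<forall>t::real. 0 \<le> t \<and> t \<le> 1 \<longrightarrow>
        qpe_le (choi_state \<Phi>) ((1 - t) *\<^sub>R choi_state \<Phi> + t *\<^sub>R choi_state \<Psi>) \<and>
        qpe_le ((1 - t) *\<^sub>R choi_state \<Phi> + t *\<^sub>R choi_state \<Psi>) (choi_state \<Psi>)"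
  from spec[OF this, of 1] show "qpe_le (choi_state \<Phi>) (choi_state \<Psi>)" by simp
qed (simp add: qpe_le_convex)

section \<open>Directed completeness and approximation\<close>

lemma up_directed_finite_bound:
  assumes dir: "up_directed X le S" and trans: "transp_on X le" and "finite F" "F \<subseteq> S"
  obtains d where "d \<in> S" "\<And>s. s \<in> F \<Longrightarrow> le s d"
proof -
  have "\<exists>d\<in>S. \<forall>s\<in>F. le s d"
    using assms(3,4)
  proof (induction rule: finite_induct)
    case empty
    then show ?case using dir by (auto simp: up_directed_def)
  next
    case (insert a F)
    then obtain d where d: "d \<in> S" "\<forall>s\<in>F. le s d" by auto
    obtain e where e: "e \<in> S" "le a e" "le d e"
      using dir d(1) insert.prems unfolding up_directed_def by blast
    have "le s e" if "s \<in> F" for s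
      using transp_onD[OF trans, of s d e] dir d e insert.prems that by (auto simp: up_directed_def)
    then show ?case using e by auto
  qed
  then show ?thesis using that by blast
qed

text \<open>The closures of the tails \<open>{d \<in> S. le s d}\<close> have the finite intersection property;
  a common point is a supremum.\<close>

lemma compact_directed_supremum:
  fixes C :: "'a::topological_space set"
  assumes "compact C" and poset: "poset_on C le"
    and up: "\<And>c. c \<in> C \<Longrightarrow> closed {d \<in> C. le c d}"
    and down: "\<And>c. c \<in> C \<Longrightarrow> closed {d \<in> C. le d c}"
    and dir: "up_directed C le S"
  obtains u where "is_supremum C le S u" "u \<in> closure S"
proof -
  have SC: "S \<subseteq> C" and ne: "S \<noteq> {}" using dir by (auto simp: up_directed_def)
  define T where "T s = closure {d \<in> S. le s d}" for s
  have "C \<inter> \<Inter> (T ` S) \<noteq> {}"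
  proof (rule compact_imp_fip[OF \<open>compact C\<close>])
    show "closed A" if "A \<in> T ` S" for A using that by (auto simp: T_def)
    fix \<F> assume "finite \<F>" "\<F> \<subseteq> T ` S"
    then obtain F where F: "finite F" "F \<subseteq> S" "\<F> = T ` F" by (meson finite_subset_image)
    obtain d where d: "d \<in> S" "\<And>s. s \<in> F \<Longrightarrow> le s d"
      using up_directed_finite_bound[OF dir _ F(1,2)] poset unfolding poset_on_def by metis
    then have "d \<in> T s" if "s \<in> F" for s
      unfolding T_def using that by (intro subsetD[OF closure_subset]) simp
    then have "d \<in> C \<inter> \<Inter> \<F>" using d SC F by auto
    then show "C \<inter> \<Inter> \<F> \<noteq> {}" by blast
  qed
  then obtain u where u: "u \<in> C" "\<And>s. s \<in> S \<Longrightarrow> u \<in> T s" by auto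
  obtain s0 where "s0 \<in> S" using ne by blast
  then have "u \<in> closure S"
    using u(2)[of s0] closure_mono[of "{d \<in> S. le s0 d}" S] by (auto simp: T_def)
  moreover have "le s u" if "s \<in> S" for s
  proof -
    have "T s \<subseteq> {d \<in> C. le s d}"
      unfolding T_def using SC that by (intro closure_minimal up) auto
    then show ?thesis using u(2)[OF that] by auto
  qed
  \<comment> \<open>\<open>S\<close> lies in the closed set of elements below \<open>v\<close>, so
    its limit point \<open>u\<close> does too.\<close>
  moreover have "le u v" if "v \<in> C" "\<forall>s\<in>S. le s v" for v
  proof -
    have "closure S \<subseteq> {d \<in> C. le d v}"
      using SC that by (intro closure_minimal down) auto
    then show ?thesis using \<open>u \<in> closure S\<close> by auto
  qed
  ultimately show ?thesis using that[of u] u(1) unfolding is_supremum_def by blast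
qed

lemma is_supremum_unique:
  assumes "poset_on X le" "is_supremum X le S u" "is_supremum X le S v"
  shows "u = v"
  using assms unfolding poset_on_def is_supremum_def by (meson antisymp_onD)

text \<open>One approximating directed set \<open>M\<close> is enough: an element way below
  \<open>x\<close> lies below some member of \<open>M\<close>, so \<open>M\<close> is cofinal in the
  full set of elements way below \<open>x\<close>.\<close>

lemma continuous_domainI:
  assumes dc: "directed_complete X le"
    and approx: "\<And>x. x \<in> X \<Longrightarrow>
      \<exists>M. up_directed X le M \<and> is_supremum X le M x \<and> (\<forall>y\<in>M. way_below X le y x)"
  shows "continuous_domain X le"
proof -
  have refl: "\<And>x. x \<in> X \<Longrightarrow> le x x"
    and trans: "\<And>x y z. x \<in> X \<Longrightarrow> y \<in> X \<Longrightarrow> z \<in> X \<Longrightarrow> le x y \<Longrightarrow> le y z \<Longrightarrow> le x z"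
    using dc unfolding directed_complete_def poset_on_def by (meson reflp_onD transp_onD)+
  have "up_directed X le {y \<in> X. way_below X le y x} \<and>
      is_supremum X le {y \<in> X. way_below X le y x} x" if x: "x \<in> X" for x
  proof -
    obtain M where M: "up_directed X le M" "is_supremum X le M x" "\<And>y. y \<in> M \<Longrightarrow> way_below X le y x"
      using approx[OF x] by blast
    have MX: "M \<subseteq> X" and ne: "M \<noteq> {}" using M(1) by (auto simp: up_directed_def)
    have below: "\<exists>m\<in>M. le y m" if "way_below X le y x" for y
      using that M(1,2) refl[OF x] unfolding way_below_def by blast
    have "up_directed X le {y \<in> X. way_below X le y x}"
      unfolding up_directed_def
    proof (intro conjI ballI)
      show "{y \<in> X. way_below X le y x} \<noteq> {}" using M(3) MX ne by auto
      fix y z assume yz: "y \<in> {y \<in> X. way_below X le y x}" "z \<in> {y \<in> X. way_below X le y x}"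
      then obtain m n where mn: "m \<in> M" "le y m" "n \<in> M" "le z n" using below by blast
      obtain l where l: "l \<in> M" "le m l" "le n l" using M(1) mn unfolding up_directed_def by blast
      have "le y l" "le z l" using trans[of y m l] trans[of z n l] yz mn l MX by auto
      then show "\<exists>l\<in>{y \<in> X. way_below X le y x}. le y l \<and> le z l" using l M(3) MX by auto
    qed auto
    moreover have "is_supremum X le {y \<in> X. way_below X le y x} x"
      unfolding is_supremum_def
    proof (intro conjI ballI impI x)
      fix y assume y: "y \<in> {y \<in> X. way_below X le y x}"
      then obtain m where "m \<in> M" "le y m" using below by blast
      then show "le y x" using trans[of y m x] y x MX M(2) by (auto simp: is_supremum_def)
    next
      fix v assume "v \<in> X" "\<forall>y\<in>{y \<in> X. way_below X le y x}. le y v"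
      moreover from this have "\<forall>y\<in>M. le y v" using M(3) MX by blast
      ultimately show "le x v" using M(2) unfolding is_supremum_def by blast
    qed
    ultimately show ?thesis by blast
  qed
  then show ?thesis using dc by (simp add: continuous_domain_def)
qed

lemma continuous_domain_iso:
  assumes f: "bij_betw f X Y" and iso: "\<And>x y. x \<in> X \<Longrightarrow> y \<in> X \<Longrightarrow> le x y \<longleftrightarrow> le' (f x) (f y)"
    and dom: "continuous_domain Y le'"
  shows "continuous_domain X le"
proof -
  have Y: "Y = f ` X" and inj: "inj_on f X" using f by (auto simp: bij_betw_def)
  have dc: "directed_complete Y le'" using dom by (simp add: continuous_domain_def)
  have dir: "up_directed X le S \<longleftrightarrow> up_directed Y le' (f ` S)" if "S \<subseteq> X" for S
  proof -
    have "(\<forall>x\<in>S. \<forall>y\<in>S. \<exists>z\<in>S. le x z \<and> le y z) \<longleftrightarrow>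
        (\<forall>x\<in>S. \<forall>y\<in>S. \<exists>z\<in>S. le' (f x) (f z) \<and> le' (f y) (f z))"
      by (intro ball_cong bex_cong refl) (use iso that in blast)
    then show ?thesis using that by (auto simp: up_directed_def Y)
  qed
  have sup: "is_supremum X le S u \<longleftrightarrow> is_supremum Y le' (f ` S) (f u)" if "S \<subseteq> X" "u \<in> X" for S u
  proof -
    have "(\<forall>s\<in>S. le s v) \<longleftrightarrow> (\<forall>s\<in>S. le' (f s) (f v))" if "v \<in> X" for v
      using iso that \<open>S \<subseteq> X\<close> by blast
    then show ?thesis using that iso by (auto simp: is_supremum_def Y)
  qed
  have wb: "way_below X le x y" if "way_below Y le' (f x) (f y)" "x \<in> X" "y \<in> X" for x y
    unfolding way_below_def
  proof (intro allI impI)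
    fix S u assume S: "up_directed X le S" and u: "is_supremum X le S u" and "le y u"
    have "S \<subseteq> X" "u \<in> X" using S u by (auto simp: up_directed_def is_supremum_def)
    then have "\<exists>s\<in>f ` S. le' (f x) s"
      using that S u \<open>le y u\<close> dir sup iso unfolding way_below_def by metis
    then show "\<exists>s\<in>S. le x s" using iso that(2) \<open>S \<subseteq> X\<close> by blast
  qed
  have "poset_on Y le'" using dc by (simp add: directed_complete_def)
  have "poset_on X le"
    unfolding poset_on_def
  proof (intro conjI reflp_onI transp_onI antisymp_onI)
    fix x y z assume *: "x \<in> X" "y \<in> X" "z \<in> X" "le x y" "le y z"
    then show "le x z"
      using \<open>poset_on Y le'\<close> transp_onD[of Y le' "f x" "f y" "f z"] iso
      by (auto simp: poset_on_def Y)
  next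
    fix x y assume "x \<in> X" "y \<in> X" "le x y" "le y x"
    then have "f x = f y"
      using \<open>poset_on Y le'\<close> antisymp_onD[of Y le' "f x" "f y"] iso by (auto simp: poset_on_def Y)
    then show "x = y" using inj \<open>x \<in> X\<close> \<open>y \<in> X\<close> by (simp add: inj_on_def)
  next
    fix x assume "x \<in> X"
    then show "le x x"
      using \<open>poset_on Y le'\<close> reflp_onD[of Y le' "f x"] iso by (auto simp: poset_on_def Y)
  qed
  moreover have "\<exists>u. is_supremum X le S u" if S: "up_directed X le S" for S
  proof -
    have SX: "S \<subseteq> X" using S by (simp add: up_directed_def)
    then obtain v where v: "is_supremum Y le' (f ` S) v"
      using dc S dir unfolding directed_complete_def by metis
    then obtain u where "u \<in> X" "v = f u" by (auto simp: is_supremum_def Y)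
    then show ?thesis using v sup SX by blast
  qed
  ultimately have "directed_complete X le" by (simp add: directed_complete_def)
  then show ?thesis
  proof (rule continuous_domainI)
    fix x assume x: "x \<in> X"
    \<comment> \<open>The preimage of the full set way below \<open>f x\<close> serves as the
      approximating set.\<close>
    define M where "M = {y \<in> X. way_below Y le' (f y) (f x)}"
    have fM: "f ` M = {z \<in> Y. way_below Y le' z (f x)}" by (auto simp: M_def Y)
    have "f x \<in> Y" using x by (simp add: Y)
    then have *: "up_directed Y le' (f ` M)" "is_supremum Y le' (f ` M) (f x)"
      using dom unfolding fM continuous_domain_def by auto
    have "M \<subseteq> X" by (auto simp: M_def)
    then show "\<exists>M. up_directed X le M \<and> is_supremum X le M x \<and> (\<forall>y\<in>M. way_below X le y x)"
      using * dir sup wb x by (intro exI[of _ M]) (auto simp: M_def)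
  qed
qed

section \<open>Compactness and closedness of the order\<close>

lemma closed_psd: "closed {A. psd A}"
proof -
  have "closed ((\<lambda>A. hdot x (A *v x)) -` \<real>\<^sub>\<ge>\<^sub>0)" for x :: "complex^'n"
    unfolding hdot_mat_eq by (intro closed_vimage closed_nonneg_Reals_complex continuous_intros)
  then have "closed (\<Inter>x :: complex^'n. (\<lambda>A. hdot x (A *v x)) -` \<real>\<^sub>\<ge>\<^sub>0)" by blast
  also have "(\<Inter>x :: complex^'n. (\<lambda>A. hdot x (A *v x)) -` \<real>\<^sub>\<ge>\<^sub>0) = {A. psd A}"
    by (auto simp: psd_def)
  finally show ?thesis .
qed

lemma norm_vec_le_sum: "norm x \<le> (\<Sum>i\<in>UNIV. norm (x $ i))"
  unfolding norm_vec_def by (rule L2_set_le_sum) simp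

text \<open>Entries are bounded by the operator norm, which is at most the trace.\<close>

lemma bounded_DO: "bounded (DO :: (complex^'n^'n) set)"
proof (rule boundedI)
  fix \<rho> :: "complex^'n^'n" assume \<rho>: "\<rho> \<in> DO"
  have entry: "norm (\<rho> $ i $ j) \<le> 1" for i j
  proof -
    have "\<rho> $ i $ j = (\<rho> *v axis j 1) $ i"
      by (simp add: matrix_vector_mult_def axis_def if_distrib[of "(*) _"] cong: if_cong)
    also have "norm \<dots> \<le> norm (\<rho> *v axis j 1)" by (rule Finite_Cartesian_Product.norm_nth_le)
    also have "\<dots> \<le> op_norm \<rho> * norm (axis j (1::complex))" by (rule norm_mat_vec_le)
    also have "\<dots> \<le> 1" using DO_op_norm_le_1[OF \<rho>] by simp
    finally show ?thesis .
  qed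
  have "norm \<rho> \<le> (\<Sum>i\<in>UNIV. norm (\<rho> $ i))" by (rule norm_vec_le_sum)
  also have "\<dots> \<le> (\<Sum>i\<in>(UNIV::'n set). \<Sum>j\<in>(UNIV::'n set). 1)"
    by (intro sum_mono order_trans[OF norm_vec_le_sum] entry)
  finally show "norm \<rho> \<le> (\<Sum>i\<in>(UNIV::'n set). \<Sum>j\<in>(UNIV::'n set). 1)" .
qed

lemma compact_choi_set: "compact (choi_set :: (complex^('n::finite \<times> 'k::finite)^('n \<times> 'k)) set)"
proof -
  have "closed (choi_set :: (complex^('n::finite \<times> 'k::finite)^('n \<times> 'k)) set)"
    unfolding choi_set_def
    by (intro closed_Collect_conj closed_psd closed_Collect_all closed_Collect_eq continuous_intros)
  then show ?thesis
    using bounded_subset[OF bounded_DO choi_set_subset_DO] by (simp add: compact_eq_bounded_closed)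
qed

text \<open>The order condition is the preimage of the closed cone of positive semidefinite matrices
  under a map that is continuous because \<open>op_norm\<close> is.\<close>

lemma choi_set_closed_up:
  assumes "c \<in> choi_set"
  shows "closed {d \<in> choi_set. qpe_le c d}"
proof -
  have "closed ((\<lambda>d. op_norm d *\<^sub>R c - op_norm c *\<^sub>R d) -` {A. psd A})"
    by (intro closed_vimage closed_psd continuous_intros continuous_on_op_norm)
  then have "closed (choi_set \<inter> ((\<lambda>d. op_norm d *\<^sub>R c - op_norm c *\<^sub>R d) -` {A. psd A}))"
    using compact_choi_set by (intro closed_Int) (auto intro: compact_imp_closed)
  also have "choi_set \<inter> ((\<lambda>d. op_norm d *\<^sub>R c - op_norm c *\<^sub>R d) -` {A. psd A}) =
      {d \<in> choi_set. qpe_le c d}"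
    using assms choi_set_subset_DO by (auto simp: qpe_le_def)
  finally show ?thesis .
qed

lemma choi_set_closed_down:
  assumes "c \<in> choi_set"
  shows "closed {d \<in> choi_set. qpe_le d c}"
proof -
  have "closed ((\<lambda>d. op_norm c *\<^sub>R d - op_norm d *\<^sub>R c) -` {A. psd A})"
    by (intro closed_vimage closed_psd continuous_intros continuous_on_op_norm)
  then have "closed (choi_set \<inter> ((\<lambda>d. op_norm c *\<^sub>R d - op_norm d *\<^sub>R c) -` {A. psd A}))"
    using compact_choi_set by (intro closed_Int) (auto intro: compact_imp_closed)
  also have "choi_set \<inter> ((\<lambda>d. op_norm c *\<^sub>R d - op_norm d *\<^sub>R c) -` {A. psd A}) =
      {d \<in> choi_set. qpe_le d c}"
    using assms choi_set_subset_DO by (auto simp: qpe_le_def)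
  finally show ?thesis .
qed

lemma poset_choi_set: "poset_on choi_set qpe_le"
  unfolding poset_on_def
proof (intro conjI reflp_onI transp_onI antisymp_onI)
  show "qpe_le J J" if "J \<in> choi_set" for J using that choi_set_subset_DO by (auto intro: qpe_le_refl)
  show "qpe_le J L" if "qpe_le J K" "qpe_le K L" for J K L using that by (rule qpe_le_trans)
  show "J = K" if "qpe_le J K" "qpe_le K J" for J K
    using that(1) qpe_le_op_norm_mono[OF that(2)] by (rule qpe_le_eqI)
qed

lemma choi_set_supremum:
  assumes "up_directed choi_set qpe_le S"
  obtains u where "is_supremum choi_set qpe_le S u" "u \<in> closure S"
  using compact_directed_supremum[OF compact_choi_set poset_choi_set choi_set_closed_up
      choi_set_closed_down assms] by blast

lemma directed_complete_choi_set: "directed_complete choi_set qpe_le"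
  unfolding directed_complete_def using poset_choi_set choi_set_supremum by metis

lemma qpe_le_bottom:
  fixes \<rho> b :: "complex^'n^'n"
  assumes "\<rho> \<in> DO" "b \<in> DO" "b = \<beta> *\<^sub>R mat 1" "0 < \<beta>"
  shows "qpe_le b \<rho>"
  using assms qf_le_op_norm[of \<rho>] by (simp add: qpe_le_iff op_norm_scaleR op_norm_mat1)

text \<open>Write \<open>A' = A / op_norm A\<close>. Members of \<open>S\<close> approach the supremum \<open>u\<close>, so \<open>s' - u'\<close>
  becomes small for some \<open>s \<in> S\<close>, while \<open>0 \<le> s' - u' \<le> I - u'\<close>; hence
  \<open>s' - u' \<le> \<mu> (I - u')\<close> and \<open>s' \<le> \<mu> I + (1 - \<mu>) u' \<le> \<mu> I + (1 - \<mu>) x'\<close>, which is the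
  normalized mixture of \<open>x\<close> with the bottom element \<open>b\<close>.\<close>

lemma way_below_mixture:
  fixes x b :: "complex^('n::finite \<times> 'k::finite)^('n \<times> 'k)"
  assumes x: "x \<in> choi_set" and b: "b \<in> choi_set" "b = \<beta> *\<^sub>R mat 1" "0 < \<beta>" and t: "0 \<le> t" "t < 1"
  shows "way_below choi_set qpe_le ((1 - t) *\<^sub>R b + t *\<^sub>R x) x"
  unfolding way_below_def
proof (intro allI impI)
  fix S u
  assume dir: "up_directed choi_set qpe_le S" and sup: "is_supremum choi_set qpe_le S u"
    and xu: "qpe_le x u"
  have S: "S \<subseteq> choi_set" and u: "u \<in> choi_set" and su: "\<And>s. s \<in> S \<Longrightarrow> qpe_le s u"
    using dir sup by (auto simp: up_directed_def is_supremum_def)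
  have DO: "J \<in> DO" if "J \<in> choi_set" for J :: "complex^('n \<times> 'k)^('n \<times> 'k)"
    using that choi_set_subset_DO by blast
  \<comment> \<open>Suprema are unique, so the given \<open>u\<close> is the one found in the
    closure of \<open>S\<close>.\<close>
  obtain u' where "is_supremum choi_set qpe_le S u'" "u' \<in> closure S"
    using choi_set_supremum[OF dir] .
  then have clos: "u \<in> closure S" using is_supremum_unique[OF poset_choi_set sup] by metis
  define y where "y = (1 - t) *\<^sub>R b + t *\<^sub>R x"
  define c h r where "c = op_norm y" and "h = op_norm u" and "r = op_norm x"
  have h: "h > 0" and r: "r > 0" using u x DO by (simp_all add: h_def r_def DO_op_norm_pos)
  have y: "y \<in> choi_set" unfolding y_def using choi_set_convex[OF b(1) x] t by simp
  \<comment> \<open>\<open>b\<close> lies below \<open>x\<close>, so the norm is affine on the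
    segment between them.\<close>
  have "c = (1 - t) * \<beta> + t * r"
    unfolding c_def y_def r_def
    using op_norm_convex[OF qpe_le_bottom[OF DO[OF x] DO[OF b(1)] b(2,3)], of t] t b
    by (simp add: op_norm_scaleR op_norm_mat1)
  moreover have "(1 - t) * \<beta> > 0" using t b by simp
  moreover have tr: "0 \<le> t * r" using t r by simp
  ultimately have c: "c = (1 - t) * \<beta> + t * r" "c > 0" by simp_all
  \<comment> \<open>The weight of the identity in the normalised mixture: y/c = \<mu> I + (1 -
    \<mu>) x/r.\<close>
  define \<mu> where "\<mu> = (1 - t) * \<beta> / c"
  have \<mu>: "\<mu> > 0" "c * \<mu> = (1 - t) * \<beta>" "c * (1 - \<mu>) = t * r"
    using c \<open>(1 - t) * \<beta> > 0\<close> by (simp_all add: \<mu>_def field_simps)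
  define H where "H = mat 1 - (1 / h) *\<^sub>R u"
  have "psd H"
    using choi_set_psd[OF u] qf_le_op_norm[of u] h by (simp add: H_def psd_iff h_def field_simps)
  then obtain \<epsilon> where \<epsilon>: "\<epsilon> > 0"
    "\<And>D z. pos_op D \<Longrightarrow> (\<And>z. z \<bullet> D z \<le> z \<bullet> (H *v z)) \<Longrightarrow> onorm D \<le> \<epsilon> \<Longrightarrow>
      z \<bullet> D z \<le> \<mu> * (z \<bullet> (H *v z))"
    using pos_op_dominated[OF psd_pos_op \<mu>(1)] by metis
  define D where "D s = (1 / op_norm s) *\<^sub>R s - (1 / h) *\<^sub>R u" for s
  \<comment> \<open>Norms of states do not vanish, so dividing by them is continuous on
    \<open>choi_set\<close>.\<close>
  have "continuous_on choi_set (\<lambda>s. op_norm (D s))"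
    unfolding D_def
    by (intro continuous_intros continuous_on_op_norm continuous_on_compose2[OF continuous_on_op_norm[of UNIV]])
      (use DO DO_op_norm_pos in force)+
  then obtain \<delta> where \<delta>: "\<delta> > 0"
    "\<And>s. s \<in> choi_set \<Longrightarrow> dist s u < \<delta> \<Longrightarrow> dist (op_norm (D s)) (op_norm (D u)) < \<epsilon>"
    using u \<epsilon>(1) unfolding continuous_on_iff by metis
  obtain s where s: "s \<in> S" "dist s u < \<delta>" using clos \<delta>(1) unfolding closure_approachable by blast
  define a where "a = op_norm s"
  have sC: "s \<in> choi_set" using s S by blast
  have a: "a > 0" using sC DO by (simp add: a_def DO_op_norm_pos)
  have "op_norm (D u) = 0"
    using op_norm_scaleR[of 0 "mat 1 :: complex^('n \<times> 'k)^('n \<times> 'k)"] by (simp add: D_def h_def)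
  then have small: "op_norm (D s) \<le> \<epsilon>" using \<delta>(2)[OF sC s(2)] by (simp add: dist_real_def)
  have qs: "a * qf u z \<le> h * qf s z" for z using su[OF s(1)] by (simp add: qpe_le_iff a_def h_def)
  have qx: "r * qf u z \<le> h * qf x z" for z using xu by (simp add: qpe_le_iff r_def h_def)
  have "psd (D s)"
    using choi_set_psd[OF u] choi_set_psd[OF sC] qs a h
    by (simp add: D_def psd_iff a_def[symmetric] field_simps)
  moreover have "qf (D s) z \<le> qf H z" for z
    using qf_le_op_norm[of s z] a by (simp add: D_def H_def a_def[symmetric] field_simps)
  ultimately have dom: "qf (D s) z \<le> \<mu> * qf H z" for z
    using \<epsilon>(2)[OF psd_pos_op] small unfolding qf_def op_norm_eq by blast
  have "c * qf s z \<le> a * qf y z" for z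
  proof -
    have "qf s z / a \<le> \<mu> * (z \<bullet> z) + (1 - \<mu>) * (qf u z / h)"
      using dom[of z] by (simp add: D_def H_def a_def[symmetric] algebra_simps diff_divide_distrib)
    also have "\<dots> \<le> \<mu> * (z \<bullet> z) + (1 - \<mu>) * (qf x z / r)"
    proof -
      have "0 \<le> 1 - \<mu>" using \<mu>(3) tr c(2) by (metis zero_le_mult_iff not_less)
      moreover have "qf u z / h \<le> qf x z / r" using qx[of z] h r by (simp add: field_simps)
      ultimately show ?thesis by (intro add_left_mono mult_left_mono)
    qed
    finally have "c * (qf s z / a) \<le> c * (\<mu> * (z \<bullet> z) + (1 - \<mu>) * (qf x z / r))"
      using c(2) by (intro mult_left_mono) auto
    also have "\<dots> = (c * \<mu>) * (z \<bullet> z) + (c * (1 - \<mu>)) * (qf x z / r)"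
      by (simp only: distrib_left mult.assoc)
    also have "\<dots> = qf y z" unfolding \<mu> using r b(2) by (simp add: y_def)
    finally show ?thesis using a by (simp add: field_simps)
  qed
  then have "qpe_le y s" using DO y sC by (simp add: qpe_le_iff c_def a_def)
  then show "\<exists>s\<in>S. qpe_le ((1 - t) *\<^sub>R b + t *\<^sub>R x) s" using s(1) by (auto simp: y_def)
qed

lemma continuous_domain_choi_set:
  "continuous_domain (choi_set :: (complex^('n::finite \<times> 'k::finite)^('n \<times> 'k)) set) qpe_le"
proof (rule continuous_domainI[OF directed_complete_choi_set])
  fix x :: "complex^('n \<times> 'k)^('n \<times> 'k)" assume x: "x \<in> choi_set"
  define \<beta> where "\<beta> = 1 / real (CARD('n) * CARD('k))"
  define b :: "complex^('n \<times> 'k)^('n \<times> 'k)" where "b = \<beta> *\<^sub>R mat 1"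
  have \<beta>: "\<beta> > 0" by (simp add: \<beta>_def)
  have b: "b \<in> choi_set"
    using depolarizing_CPTP[where 'n = 'n and 'k = 'k]
    by (simp only: CPTP_iff choi_state_depolarizing b_def \<beta>_def)
  have DO: "J \<in> DO" if "J \<in> choi_set" for J :: "complex^('n \<times> 'k)^('n \<times> 'k)"
    using that choi_set_subset_DO by blast
  have bot: "qpe_le b J" if "J \<in> choi_set" for J
    using that b \<beta> by (intro qpe_le_bottom DO) (auto simp: b_def)
  define y where "y t = (1 - t) *\<^sub>R b + t *\<^sub>R x" for t
  have y: "y t \<in> choi_set" if "0 \<le> t" "t < 1" for t
    unfolding y_def using that choi_set_convex[OF b x, of t] by simp
  have mono: "qpe_le (y s) (y t)" if st: "0 \<le> s" "s \<le> t" "t < 1" for s t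
  proof (cases "t = 0")
    case True
    then show ?thesis using st y[of t] by (auto intro: qpe_le_refl DO)
  next
    case False
    \<comment> \<open>\<open>y s\<close> is itself a mixture of \<open>b\<close> and the later point
      \<open>y t\<close>; the division by \<open>t\<close> is why \<open>t = 0\<close> is a separate
      case.\<close>
    have "y s = (1 - s / t) *\<^sub>R b + (s / t) *\<^sub>R y t"
      using False by (simp add: y_def algebra_simps)
    moreover have "qpe_le ((1 - s / t) *\<^sub>R b + (s / t) *\<^sub>R y t) (y t)"
      using st False by (intro qpe_le_convex(2) bot y) auto
    ultimately show ?thesis by simp
  qed
  \<comment> \<open>The endpoint would be \<open>x\<close> itself; \<open>way_below_mixture\<close>
    requires \<open>t < 1\<close>.\<close>
  define M where "M = y ` {0..<1}"
  have "up_directed choi_set qpe_le M"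
    unfolding up_directed_def
  proof (intro conjI ballI)
    show "M \<subseteq> choi_set" "M \<noteq> {}" using y by (auto simp: M_def)
    fix p q assume "p \<in> M" "q \<in> M"
    then obtain s t where "p = y s" "q = y t" "0 \<le> s" "s < 1" "0 \<le> t" "t < 1" by (auto simp: M_def)
    then show "\<exists>z\<in>M. qpe_le p z \<and> qpe_le q z"
      using mono[of s "max s t"] mono[of t "max s t"] by (intro bexI[of _ "y (max s t)"]) (auto simp: M_def)
  qed
  moreover have "is_supremum choi_set qpe_le M x"
    unfolding is_supremum_def
  proof (intro conjI ballI impI x)
    fix p assume "p \<in> M"
    then show "qpe_le p x" using qpe_le_convex(2)[OF bot[OF x]] by (auto simp: M_def y_def)
  next
    fix v assume v: "v \<in> choi_set" "\<forall>p\<in>M. qpe_le p v"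
    have "M \<subseteq> {d \<in> choi_set. qpe_le d v}" using v y by (auto simp: M_def)
    then have "closure M \<subseteq> {d \<in> choi_set. qpe_le d v}"
      by (intro closure_minimal choi_set_closed_down v)
    \<comment> \<open>The half-open segment reaches \<open>x\<close> only as the limit at 1, so
      closedness of the order passes the bound on to \<open>x\<close>.\<close>
    moreover have "x \<in> closure M"
    proof -
      have "continuous_on (closure {0..<1}) y" unfolding y_def by (intro continuous_intros)
      then have "y ` closure {0..<1} \<subseteq> closure M"
        by (rule image_closure_subset) (auto simp: M_def intro: subsetD[OF closure_subset])
      moreover have "1 \<in> closure {0..<1::real}" by simp
      ultimately have "y 1 \<in> closure M" by blast
      then show ?thesis by (simp add: y_def)
    qed
    ultimately show "qpe_le x v" by blast
  qed
  moreover have "\<forall>p\<in>M. way_below choi_set qpe_le p x"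
    using way_below_mixture[OF x b b_def \<beta>] by (auto simp: M_def y_def)
  ultimately show "\<exists>M. up_directed choi_set qpe_le M \<and> is_supremum choi_set qpe_le M x \<and>
      (\<forall>y\<in>M. way_below choi_set qpe_le y x)" by blast
qed

lemma continuous_domain_CPTP:
  "continuous_domain (CPTP :: (complex^'n^'n \<Rightarrow> complex^'k^'k) set) channel_le"
  by (rule continuous_domain_iso[OF bij_betw_choi_state _ continuous_domain_choi_set])
    (simp add: channel_le_def)

theorem lemma22:
  shows
    "((depolarizing :: complex^'n^'n \<Rightarrow> complex^'k^'k) \<in> CPTP \<and>
      (\<forall>\<Phi> \<in> (CPTP :: (complex^'n^'n \<Rightarrow> complex^'k^'k) set). channel_le depolarizing \<Phi>))
    \<and>
     (\<forall>V :: complex^'n^'k. adjoint_mat V ** V = mat 1 \<longrightarrow>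
        kraus1 V \<in> CPTP \<and> (\<forall>\<Psi> \<in> CPTP. channel_le (kraus1 V) \<Psi> \<longrightarrow> \<Psi> = kraus1 V))
    \<and>
     (\<forall>\<Phi> \<in> (CPTP :: (complex^'n^'n \<Rightarrow> complex^'k^'k) set). \<forall>\<Psi> \<in> CPTP.
        (\<forall>t::real. 0 \<le> t \<and> t \<le> 1 \<longrightarrow> (\<lambda>A. (1 - t) *\<^sub>R \<Phi> A + t *\<^sub>R \<Psi> A) \<in> CPTP) \<and>
        (channel_le \<Phi> \<Psi> \<longleftrightarrow>
         (\<forall>t::real. 0 \<le> t \<and> t \<le> 1 \<longrightarrow>
            channel_le \<Phi> (\<lambda>A. (1 - t) *\<^sub>R \<Phi> A + t *\<^sub>R \<Psi> A) \<and>
            channel_le (\<lambda>A. (1 - t) *\<^sub>R \<Phi> A + t *\<^sub>R \<Psi> A) \<Psi>)))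
    \<and>
     (\<forall>\<Phi>\<^sub>1 \<in> (CPTP :: (complex^'n1^'n1 \<Rightarrow> complex^'k1^'k1) set). \<forall>\<Psi>\<^sub>1 \<in> CPTP.
      \<forall>\<Phi>\<^sub>2 \<in> (CPTP :: (complex^'n2^'n2 \<Rightarrow> complex^'k2^'k2) set). \<forall>\<Psi>\<^sub>2 \<in> CPTP.
        channel_le \<Phi>\<^sub>1 \<Psi>\<^sub>1 \<and> channel_le \<Phi>\<^sub>2 \<Psi>\<^sub>2 \<longrightarrow>
        tensor_map \<Phi>\<^sub>1 \<Phi>\<^sub>2 \<in> CPTP \<and> tensor_map \<Psi>\<^sub>1 \<Psi>\<^sub>2 \<in> CPTP \<and>
        channel_le (tensor_map \<Phi>\<^sub>1 \<Phi>\<^sub>2) (tensor_map \<Psi>\<^sub>1 \<Psi>\<^sub>2))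
    \<and>
     directed_complete (CPTP :: (complex^'n^'n \<Rightarrow> complex^'k^'k) set) channel_le
    \<and>
     continuous_domain (CPTP :: (complex^'n^'n \<Rightarrow> complex^'k^'k) set) channel_le"
  using depolarizing_CPTP depolarizing_le kraus1_CPTP kraus1_maximal CPTP_convex channel_le_convex_iff
    tensor_map_CPTP channel_le_tensor_map continuous_domain_CPTP[unfolded continuous_domain_def]
    continuous_domain_CPTP
  by (intro conjI ballI allI impI) blast+

end
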